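(* Let $\Omega\subseteq\mathbb H$ be open and let $f\in\mathcal{SR}_{loc}(\Omega)$. Assume that the open ball $B(a,r)$ with centre $a\in\Omega$ and radius $r$ has closure $\overline{B(a,r)}$ contained in $\Omega$. Then, for every $x$ in the open unit ball $\mathbb B$ of $\mathbb R^4\simeq\mathbb H$, $$f(a+rx)=\int_{\mathbb S^3}f(a+r\zeta)P(x,\zeta)\,d\sigma(\zeta)-r\int_{\mathbb S^3}(\overline\zeta-\overline x)\,\overline\partial f(a+r\zeta)\,P(x,\zeta)\,d\sigma(\zeta).$$
   Context: $\mathbb H\simeq\mathbb R^4$ is the skew field of quaternions, $x=x_0+ix_1+jx_2+kx_3$ with conjugate $\overline x$, $\mathbb S_{\mathbb H}$ the sphere of imaginary units, $\mathbb C_I=\mathrm{span}(1,I)$ for $I\in\mathbb S_{\mathbb H}$, $\mathbb S_x=\alpha+\beta\,\mathbb S_{\mathbb H}$ if $x=\alpha+\beta I$, and $\overline\partial=\frac12(\partial_0+i\partial_1+j\partial_2+k\partial_3)$ is the Cauchy-Riemann-Fueter operator. $\mathbb S^3$ is the unit sphere of $\mathbb H\simeq\mathbb R^4$, $\sigma$ its normalized rotation-invariant surface measure, $\sigma(\mathbb S^3)=1$, and $P(x,\zeta)=(1-|x|^2)/|x-\zeta|^4$ is the Poisson kernel of the unit ball $\mathbb B$. $\mathcal{SR}_{loc}(\Omega)$ (locally slice-regular functions) is the set of $\mathcal C^1$ functions $f:\Omega\to\mathbb H$ such that (i) for every $I\in\mathbb S_{\mathbb H}$ with $\Omega\cap\mathbb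 C_I\ne\emptyset$, $f|_{\Omega\cap\mathbb C_I}$ is holomorphic w.r.t. the complex structures given by left multiplication by $I$, and (ii) $\overline\partial f$ and $\overline\partial(xf)$ are locally constant on $\mathbb S_y\cap\Omega$ for every $y\in\Omega$. *)

theory Defs
  imports "HOL-Probability.Probability"
begin

section \<open>The skew field of quaternions\<close>

codatatype quat = Quat (qRe: real) (qI: real) (qJ: real) (qK: real)

lemma quat_eq_iff: "x = y \<longleftrightarrow> qRe x = qRe y \<and> qI x = qI y \<and> qJ x = qJ y \<and> qK x = qK y"
  by (cases x; cases y) simp

instantiation quat :: ab_group_add
begin

primcorec zero_quat where
  "qRe 0 = 0" | "qI 0 = 0" | "qJ 0 = 0" | "qK 0 = 0"

primcorec plus_quat where
  "qRe (x + y) = qRe x + qRe y"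
| "qI (x + y) = qI x + qI y"
| "qJ (x + y) = qJ x + qJ y"
| "qK (x + y) = qK x + qK y"

primcorec uminus_quat where
  "qRe (- x) = - qRe x"
| "qI (- x) = - qI x"
| "qJ (- x) = - qJ x"
| "qK (- x) = - qK x"

primcorec minus_quat where
  "qRe (x - y) = qRe x - qRe y"
| "qI (x - y) = qI x - qI y"
| "qJ (x - y) = qJ x - qJ y"
| "qK (x - y) = qK x - qK y"

instance
  by standard (simp_all add: quat_eq_iff)

end

instantiation quat :: real_vector
begin

primcorec scaleR_quat where
  "qRe (scaleR r x) = r * qRe x"
| "qI (scaleR r x) = r * qI x"
| "qJ (scaleR r x) = r * qJ x"
| "qK (scaleR r x) = r * qK x"

instance
  by standard (simp_all add: quat_eq_iff algebra_simps)

end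

instantiation quat :: euclidean_space
begin

definition inner_quat :: "quat \<Rightarrow> quat \<Rightarrow> real" where
  "inner_quat x y = qRe x * qRe y + qI x * qI y + qJ x * qJ y + qK x * qK y"

definition norm_quat :: "quat \<Rightarrow> real" where
  "norm_quat x = sqrt ((qRe x)\<^sup>2 + (qI x)\<^sup>2 + (qJ x)\<^sup>2 + (qK x)\<^sup>2)"

definition sgn_quat :: "quat \<Rightarrow> quat" where
  "sgn_quat x = x /\<^sub>R norm x"

definition dist_quat :: "quat \<Rightarrow> quat \<Rightarrow> real" where
  "dist_quat x y = norm (x - y)"

definition uniformity_quat :: "(quat \<times> quat) filter" where
  "uniformity_quat = (INF e\<in>{0 <..}. principal {(x, y). dist x y < e})"

definition open_quat :: "quat set \<Rightarrow> bool" where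
  "open_quat U \<longleftrightarrow> (\<forall>x\<in>U. eventually (\<lambda>(x', y). x' = x \<longrightarrow> y \<in> U) uniformity)"

definition Basis_quat :: "quat set" where
  "Basis_quat = {Quat 1 0 0 0, Quat 0 1 0 0, Quat 0 0 1 0, Quat 0 0 0 1}"

instance
proof
  fix x :: quat
  show "inner x x = 0 \<longleftrightarrow> x = 0"
    by (simp add: inner_quat_def quat_eq_iff power2_eq_square [symmetric] add_nonneg_eq_0_iff)
  show "(\<forall>u\<in>Basis. inner x u = 0) \<longleftrightarrow> x = 0"
    unfolding Basis_quat_def by (simp add: inner_quat_def quat_eq_iff [of x 0])
qed (auto simp: inner_quat_def norm_quat_def sgn_quat_def dist_quat_def uniformity_quat_def
       open_quat_def Basis_quat_def algebra_simps power2_eq_square)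

end

instantiation quat :: real_normed_div_algebra
begin

primcorec one_quat where
  "qRe 1 = 1" | "qI 1 = 0" | "qJ 1 = 0" | "qK 1 = 0"

primcorec times_quat where
  "qRe (x * y) = qRe x * qRe y - qI x * qI y - qJ x * qJ y - qK x * qK y"
| "qI (x * y) = qRe x * qI y + qI x * qRe y + qJ x * qK y - qK x * qJ y"
| "qJ (x * y) = qRe x * qJ y - qI x * qK y + qJ x * qRe y + qK x * qI y"
| "qK (x * y) = qRe x * qK y + qI x * qJ y - qJ x * qI y + qK x * qRe y"

definition inverse_quat :: "quat \<Rightarrow> quat" where
  "inverse_quat x = Quat (qRe x) (- qI x) (- qJ x) (- qK x) /\<^sub>R (norm x)\<^sup>2"

definition divide_quat :: "quat \<Rightarrow> quat \<Rightarrow> quat" where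
  "divide_quat x y = x * inverse y"

lemma norm_quat_sq: "(norm x)\<^sup>2 = (qRe x)\<^sup>2 + (qI x)\<^sup>2 + (qJ x)\<^sup>2 + (qK x)\<^sup>2" for x :: quat
  by (simp add: norm_quat_def)

instance
proof
  fix x y :: quat
  show "norm (x * y) = norm x * norm y"
  proof -
    have "(norm (x * y))\<^sup>2 = (norm x * norm y)\<^sup>2"
      unfolding power_mult_distrib norm_quat_sq by (simp add: power2_eq_square algebra_simps)
    then show ?thesis
      by (simp add: power2_eq_iff_nonneg)
  qed
  show "x \<noteq> 0 \<Longrightarrow> inverse x * x = 1" "x \<noteq> 0 \<Longrightarrow> x * inverse x = 1"
  proof -
    assume "x \<noteq> 0"
    then have "(norm x)\<^sup>2 \<noteq> 0" by simp
    then have "inverse ((norm x)\<^sup>2) * ((qRe x)\<^sup>2 + (qI x)\<^sup>2 + (qJ x)\<^sup>2 + (qK x)\<^sup>2) = 1"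
      by (simp add: norm_quat_sq)
    then show "inverse x * x = 1" "x * inverse x = 1"
      unfolding inverse_quat_def quat_eq_iff
      by (simp_all add: power2_eq_square algebra_simps)
  qed
qed (auto simp: quat_eq_iff algebra_simps divide_quat_def inverse_quat_def)

end

definition quat_i :: quat where "quat_i = Quat 0 1 0 0"
definition quat_j :: quat where "quat_j = Quat 0 0 1 0"
definition quat_k :: quat where "quat_k = Quat 0 0 0 1"

lemma quat_unit_products:
  "quat_i * quat_i = - 1" "quat_j * quat_j = - 1" "quat_k * quat_k = - 1"
  "quat_i * quat_j = quat_k" "quat_j * quat_k = quat_i" "quat_k * quat_i = quat_j"
  "quat_j * quat_i = - quat_k" "quat_k * quat_j = - quat_i" "quat_i * quat_k = - quat_j"
  by (simp_all add: quat_eq_iff quat_i_def quat_j_def quat_k_def)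

lemma Basis_quat_eq: "Basis = {1, quat_i, quat_j, quat_k}"
proof -
  have "Quat 1 0 0 0 = 1"
    by (simp add: quat_eq_iff)
  then show ?thesis
    by (simp add: Basis_quat_def quat_i_def quat_j_def quat_k_def)
qed

primcorec qcnj :: "quat \<Rightarrow> quat" where
  "qRe (qcnj x) = qRe x"
| "qI (qcnj x) = - qI x"
| "qJ (qcnj x) = - qJ x"
| "qK (qcnj x) = - qK x"


section \<open>Locally slice-regular functions\<close>

definition imag_units :: "quat set" where
  "imag_units = {I. I * I = - 1}"

lemma imag_units_eq: "imag_units = {I. qRe I = 0 \<and> norm I = 1}"
proof (intro set_eqI)
  fix I :: quat
  have "norm I = 1 \<longleftrightarrow> (qRe I)\<^sup>2 + (qI I)\<^sup>2 + (qJ I)\<^sup>2 + (qK I)\<^sup>2 = 1"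
    by (simp add: norm_quat_def)
  moreover have "I * I = - 1 \<longleftrightarrow> qRe I = 0 \<and> (qRe I)\<^sup>2 + (qI I)\<^sup>2 + (qJ I)\<^sup>2 + (qK I)\<^sup>2 = 1"
  proof
    assume "I * I = - 1"
    then have eq: "qRe I * qRe I - qI I * qI I - qJ I * qJ I - qK I * qK I = - 1"
      "qRe I * qI I = 0" "qRe I * qJ I = 0" "qRe I * qK I = 0"
      by (auto simp: quat_eq_iff)
    have "qRe I = 0"
    proof (rule ccontr)
      assume "qRe I \<noteq> 0"
      with eq have "qRe I * qRe I = - 1" by simp
      then show False using zero_le_square[of "qRe I"] by linarith
    qed
    then show "qRe I = 0 \<and> (qRe I)\<^sup>2 + (qI I)\<^sup>2 + (qJ I)\<^sup>2 + (qK I)\<^sup>2 = 1"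
      using eq(1) by (simp add: power2_eq_square)
  next
    assume "qRe I = 0 \<and> (qRe I)\<^sup>2 + (qI I)\<^sup>2 + (qJ I)\<^sup>2 + (qK I)\<^sup>2 = 1"
    then show "I * I = - 1"
      by (auto simp: quat_eq_iff power2_eq_square)
  qed
  ultimately show "I \<in> imag_units \<longleftrightarrow> I \<in> {I. qRe I = 0 \<and> norm I = 1}"
    by (auto simp: imag_units_def)
qed

definition slice_plane :: "quat \<Rightarrow> quat set" where
  "slice_plane I = span {1, I}"

text \<open>The set \<open>\<alpha> + \<beta> S\<close> for \<open>x = \<alpha> + \<beta> I\<close>, where \<open>S\<close> is the sphere of imaginary units;
  it does not depend on the chosen representation of \<open>x\<close>.\<close>

definition slice_sphere :: "quat \<Rightarrow> quat set" where
  "slice_sphere x = {y. \<exists>\<alpha> \<beta>. \<exists>I\<in>imag_units. \<exists>J\<in>imag_units.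
     x = of_real \<alpha> + of_real \<beta> * I \<and> y = of_real \<alpha> + of_real \<beta> * J}"

definition partial_deriv :: "quat \<Rightarrow> (quat \<Rightarrow> quat) \<Rightarrow> quat \<Rightarrow> quat" where
  "partial_deriv e f x = vector_derivative (\<lambda>t. f (x + t *\<^sub>R e)) (at 0)"

definition crf_op :: "(quat \<Rightarrow> quat) \<Rightarrow> quat \<Rightarrow> quat" where
  "crf_op f x = (1 / 2) *\<^sub>R (partial_deriv 1 f x + quat_i * partial_deriv quat_i f x
     + quat_j * partial_deriv quat_j f x + quat_k * partial_deriv quat_k f x)"

definition C1_on :: "quat set \<Rightarrow> (quat \<Rightarrow> quat) \<Rightarrow> bool" where
  "C1_on \<Omega> f \<longleftrightarrow> (\<exists>f' :: quat \<Rightarrow> quat \<Rightarrow>\<^sub>L quat.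
     (\<forall>x\<in>\<Omega>. (f has_derivative blinfun_apply (f' x)) (at x)) \<and> continuous_on \<Omega> f')"

text \<open>Holomorphy on a subset \<open>U\<close> (relatively open) of the plane \<open>slice_plane I\<close>: real
  differentiability along the plane, with a differential that commutes with left multiplication
  by \<open>I\<close>.  The values of \<open>D\<close> off the plane are irrelevant.\<close>

definition slice_holomorphic_on :: "quat \<Rightarrow> quat set \<Rightarrow> (quat \<Rightarrow> quat) \<Rightarrow> bool" where
  "slice_holomorphic_on I U f \<longleftrightarrow> (\<forall>z\<in>U. \<exists>D. (f has_derivative D) (at z within U) \<and>
     (\<forall>v\<in>slice_plane I. D (I * v) = I * D v))"

definition SR_loc :: "quat set \<Rightarrow> (quat \<Rightarrow> quat) set" where
  "SR_loc \<Omega> = {f. C1_on \<Omega> f \<and>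
     (\<forall>I\<in>imag_units. \<Omega> \<inter> slice_plane I \<noteq> {} \<longrightarrow> slice_holomorphic_on I (\<Omega> \<inter> slice_plane I) f) \<and>
     (\<forall>y\<in>\<Omega>. locally (\<lambda>U. crf_op f constant_on U) (slice_sphere y \<inter> \<Omega>) \<and>
             locally (\<lambda>U. crf_op (\<lambda>x. x * f x) constant_on U) (slice_sphere y \<inter> \<Omega>))}"


section \<open>Poisson kernel and surface measure\<close>

definition poisson_kernel :: "quat \<Rightarrow> quat \<Rightarrow> real" where
  "poisson_kernel x \<zeta> = (1 - (norm x)\<^sup>2) / (norm (x - \<zeta>)) ^ 4"

text \<open>The normalized surface measure of the unit sphere, as the radial projection of the normalized
  Lebesgue measure of the unit ball.  The lemmas below show that it is the unique Borel probability measure on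
  the sphere that is invariant under rotations.\<close>

definition sphere_measure :: "quat measure" where
  "sphere_measure =
     restrict_space (distr (uniform_measure lborel (ball 0 1)) borel sgn) (sphere 0 1)"

lemma sets_sphere_measure: "sets sphere_measure = sets (restrict_space borel (sphere 0 1))"
  by (simp add: sphere_measure_def sets_restrict_space)

lemma space_sphere_measure [simp]: "space sphere_measure = sphere 0 1"
  by (simp add: sphere_measure_def space_restrict_space)

lemma emeasure_ball_quat:
  "emeasure lborel (ball 0 1 :: quat set) \<noteq> 0" "emeasure lborel (ball 0 1 :: quat set) \<noteq> \<infinity>"
proof -
  show "emeasure lborel (ball 0 1 :: quat set) \<noteq> 0"
    using content_ball_pos [of 1 "0 :: quat"] by (auto simp: measure_def)
  show "emeasure lborel (ball 0 1 :: quat set) \<noteq> \<infinity>"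
    using emeasure_lborel_ball_finite[of "0 :: quat" 1] by (simp add: less_top)
qed

lemma emeasure_sphere_measure:
  assumes A: "A \<in> sets borel" "A \<subseteq> sphere 0 1"
  shows "emeasure sphere_measure A =
    emeasure lborel (ball 0 1 \<inter> sgn -` A) / emeasure lborel (ball 0 1 :: quat set)"
proof -
  have "sgn -` A \<in> sets (borel :: quat measure)"
    using A(1) by (rule measurable_sets_borel[OF borel_measurable_sgn])
  then show ?thesis
    unfolding sphere_measure_def using A
    by (subst emeasure_restrict_space) (auto simp: emeasure_distr)
qed

lemma prob_space_sphere_measure: "prob_space sphere_measure"
proof (rule prob_spaceI)
  let ?B = "ball 0 1 :: quat set"
  have m: "sgn -` sphere 0 1 \<in> sets (borel :: quat measure)"
    by (rule measurable_sets_borel[OF borel_measurable_sgn]) auto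
  have "AE x in lborel. x \<in> ?B \<inter> sgn -` sphere 0 1 \<longleftrightarrow> x \<in> ?B"
    using AE_lborel_singleton[of 0] by eventually_elim (auto simp: norm_sgn)
  then have "emeasure lborel (?B \<inter> sgn -` sphere 0 1) = emeasure lborel ?B"
    using m by (intro emeasure_eq_AE) auto
  then show "emeasure sphere_measure (space sphere_measure) = 1"
    using emeasure_ball_quat
    by (simp add: emeasure_sphere_measure ennreal_divide_self top.not_eq_extremum)
qed

lemma lborel_distr_orthogonal_vec:
  fixes T :: "real^4 \<Rightarrow> real^4"
  assumes T: "orthogonal_transformation T"
  shows "distr lborel borel T = lborel"
proof (rule lborel_eqI [symmetric])
  fix l u :: "real^4"
  assume lu: "\<And>b. b \<in> Basis \<Longrightarrow> l \<bullet> b \<le> u \<bullet> b"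
  have cont: "continuous_on UNIV T"
    using T by (simp add: linear_continuous_on linear_linear orthogonal_transformation_linear)
  have [measurable]: "T \<in> borel_measurable borel"
    using cont by (rule borel_measurable_continuous_onI)
  have inv: "orthogonal_transformation (inv T)"
    using T by (rule orthogonal_transformation_inv)
  have bij: "bij T"
    using T by (rule orthogonal_transformation_bij)
  have eq: "T -` box l u = inv T ` box l u"
    using bij by (rule bij_vimage_eq_inv_image)
  have op: "open (T -` box l u)"
    using cont by (intro open_vimage) auto
  have lm: "inv T ` box l u \<in> lmeasurable"
    by (intro measurable_orthogonal_image[OF inv]) auto
  have "emeasure lebesgue (inv T ` box l u) = emeasure lebesgue (box l u)"
    using measure_orthogonal_image[OF inv, of "box l u"] lm
    by (simp add: emeasure_eq_measure2)
  then have "emeasure lborel (T -` box l u) = emeasure lborel (box l u)"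
    using op by (simp add: eq [symmetric] emeasure_completion)
  then show "emeasure (distr lborel borel T) (box l u) = (\<Prod>b\<in>Basis. (u - l) \<bullet> b)"
    using lu by (simp add: emeasure_distr)
qed simp

definition quat_of_vec :: "real^4 \<Rightarrow> quat" where
  "quat_of_vec v = Quat (v $ 1) (v $ 2) (v $ 3) (v $ 4)"

definition vec_of_quat :: "quat \<Rightarrow> real^4" where
  "vec_of_quat x = (\<chi> i. if i = 1 then qRe x else if i = 2 then qI x else if i = 3 then qJ x else qK x)"

lemma quat_vec_inverse [simp]:
  "quat_of_vec (vec_of_quat x) = x" "vec_of_quat (quat_of_vec v) = v"
  by (simp_all add: quat_of_vec_def vec_of_quat_def quat_eq_iff vec_eq_iff forall_4)

lemma linear_quat_of_vec: "linear quat_of_vec"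
  by (rule linearI) (simp_all add: quat_of_vec_def quat_eq_iff)

lemma linear_vec_of_quat: "linear vec_of_quat"
  by (rule linearI) (simp_all add: vec_of_quat_def vec_eq_iff forall_4)

lemma norm_quat_of_vec: "norm (quat_of_vec v) = norm v"
  by (simp add: norm_quat_def quat_of_vec_def norm_vec_def L2_set_def sum_4)

lemma lborel_distr_quat_of_vec: "distr lborel borel quat_of_vec = lborel"
proof (rule lborel_eqI [symmetric])
  fix l u :: quat
  assume lu: "\<And>b. b \<in> Basis \<Longrightarrow> l \<bullet> b \<le> u \<bullet> b"
  have [measurable]: "quat_of_vec \<in> borel_measurable borel"
    by (intro borel_measurable_continuous_onI linear_continuous_on)
       (simp add: linear_linear linear_quat_of_vec)
  have eq: "quat_of_vec -` box l u = box (vec_of_quat l) (vec_of_quat u)"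
    unfolding set_eq_iff vimage_eq mem_box_cart forall_4 mem_box Basis_quat_def
    by (simp add: inner_quat_def quat_of_vec_def vec_of_quat_def)
  have Basis4: "(Basis :: (real^4) set) = {axis 1 1, axis 2 1, axis 3 1, axis 4 1}"
    by (simp add: Basis_vec_def UNIV_4 insert_commute)
  have "\<forall>b\<in>Basis. vec_of_quat l \<bullet> b \<le> vec_of_quat u \<bullet> b"
    using lu[of "Quat 1 0 0 0"] lu[of "Quat 0 1 0 0"] lu[of "Quat 0 0 1 0"] lu[of "Quat 0 0 0 1"]
    unfolding Basis4 Basis_quat_def by (simp add: inner_axis inner_quat_def vec_of_quat_def)
  then have "emeasure lborel (box (vec_of_quat l) (vec_of_quat u)) =
      (\<Prod>b\<in>Basis. (vec_of_quat u - vec_of_quat l) \<bullet> b)"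
    by simp
  also have "\<dots> = (\<Prod>b\<in>Basis. (u - l) \<bullet> b)"
    unfolding Basis4 Basis_quat_def
    by (simp add: axis_eq_axis inner_axis inner_quat_def vec_of_quat_def)
  finally show "emeasure (distr lborel borel quat_of_vec) (box l u) = (\<Prod>b\<in>Basis. (u - l) \<bullet> b)"
    by (simp add: emeasure_distr eq)
qed simp

lemma lborel_distr_orthogonal_quat:
  fixes T :: "quat \<Rightarrow> quat"
  assumes T: "orthogonal_transformation T"
  shows "distr lborel borel T = lborel"
proof -
  let ?S = "vec_of_quat \<circ> T \<circ> quat_of_vec"
  have linT: "linear T"
    using T by (rule orthogonal_transformation_linear)
  have [measurable]: "quat_of_vec \<in> borel_measurable borel" "vec_of_quat \<in> borel_measurable borel"
    "T \<in> borel_measurable borel"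
    by (intro borel_measurable_continuous_onI linear_continuous_on;
        simp add: linear_linear linear_quat_of_vec linear_vec_of_quat linT)+
  have "norm (vec_of_quat x) = norm x" for x
    using norm_quat_of_vec [of "vec_of_quat x"] by simp
  then have S: "orthogonal_transformation ?S"
    using T by (auto simp: orthogonal_transformation norm_quat_of_vec
        intro!: linear_compose linear_quat_of_vec linear_vec_of_quat)
  have "distr lborel borel T = distr (distr lborel borel quat_of_vec) borel T"
    by (simp add: lborel_distr_quat_of_vec)
  also have "\<dots> = distr (distr lborel borel ?S) borel quat_of_vec"
    by (simp add: distr_distr comp_def)
  also have "\<dots> = lborel"
    by (simp only: lborel_distr_orthogonal_vec[OF S] lborel_distr_quat_of_vec)
  finally show ?thesis .
qed

lemma orthogonal_measurable_sphere:
  assumes T: "orthogonal_transformation T"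
  shows "T \<in> measurable sphere_measure sphere_measure"
proof -
  have "continuous_on (sphere 0 1) T"
    using T by (simp add: linear_continuous_on linear_linear orthogonal_transformation_linear)
  then have "T \<in> measurable (restrict_space borel (sphere 0 1)) borel"
    by (rule borel_measurable_continuous_on_restrict)
  then have "T \<in> measurable (restrict_space borel (sphere 0 1)) (restrict_space borel (sphere 0 1))"
    using T by (intro measurable_restrict_space2)
      (auto simp: space_restrict_space orthogonal_transformation_norm)
  then show ?thesis
    by (simp add: measurable_cong_sets[OF sets_sphere_measure sets_sphere_measure])
qed

lemma sphere_measure_rotation_invariant:
  assumes T: "orthogonal_transformation T"
  shows "distr sphere_measure sphere_measure T = sphere_measure"
proof (rule measure_eqI)
  fix A assume "A \<in> sets (distr sphere_measure sphere_measure T)"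
  then have A': "A \<in> sets sphere_measure" by simp
  then have A: "A \<in> sets borel" "A \<subseteq> sphere 0 1"
    by (auto simp: sets_sphere_measure sets_restrict_space)
  note mT = orthogonal_measurable_sphere[OF T]
  have linT: "linear T"
    using T by (rule orthogonal_transformation_linear)
  have [measurable]: "T \<in> borel_measurable borel"
    by (intro borel_measurable_continuous_onI linear_continuous_on) (simp add: linear_linear linT)
  have TA: "T -` A \<in> sets borel"
    using A(1) by (rule measurable_sets_borel[rotated]) simp
  have TA2: "T -` A \<subseteq> sphere 0 1"
  proof
    fix x assume "x \<in> T -` A"
    with A(2) have "norm (T x) = 1" by auto
    then show "x \<in> sphere 0 1" using T by (simp add: orthogonal_transformation_norm)
  qed
  have sT: "T (sgn x) = sgn (T x)" for x
    using T linT by (simp add: sgn_div_norm orthogonal_transformation_norm linear_cmul)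
  have sA: "sgn -` A \<in> sets (borel :: quat measure)"
    using A(1) by (rule measurable_sets_borel[OF borel_measurable_sgn])
  have "emeasure (distr sphere_measure sphere_measure T) A = emeasure sphere_measure (T -` A)"
    using TA2 by (subst emeasure_distr[OF mT A']) (simp add: Int_absorb2)
  also have "\<dots> = emeasure lborel (ball 0 1 \<inter> sgn -` (T -` A)) / emeasure lborel (ball 0 1 :: quat set)"
    by (rule emeasure_sphere_measure[OF TA TA2])
  also have "ball 0 1 \<inter> sgn -` (T -` A) = T -` (ball 0 1 \<inter> sgn -` A)"
    using T by (auto simp: sT orthogonal_transformation_norm)
  also have "emeasure lborel (T -` (ball 0 1 \<inter> sgn -` A)) =
      emeasure (distr lborel borel T) (ball 0 1 \<inter> sgn -` A)"
    using sA by (subst emeasure_distr) auto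
  also have "\<dots> = emeasure lborel (ball 0 1 \<inter> sgn -` A)"
    by (simp add: lborel_distr_orthogonal_quat[OF T])
  finally show "emeasure (distr sphere_measure sphere_measure T) A = emeasure sphere_measure A"
    by (simp add: emeasure_sphere_measure[OF A])
qed simp

text \<open>Left multiplications by unit quaternions are rotations, so a rotation-invariant measure
  satisfies the hypotheses on \<open>M\<close>.\<close>

lemma sphere_measure_unique:
  assumes "prob_space M" and sets_M: "sets M = sets sphere_measure"
    and inv: "\<And>u. norm u = 1 \<Longrightarrow> distr M M ((*) u) = M"
  shows "M = sphere_measure"
proof (rule measure_eqI)
  fix A assume "A \<in> sets M"
  then have A: "A \<in> sets sphere_measure" by (simp add: sets_M)
  interpret M: prob_space M by fact
  interpret S: prob_space sphere_measure by (rule prob_space_sphere_measure)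
  interpret P: pair_sigma_finite M sphere_measure ..
  have sp: "space M = sphere 0 1"
    using sets_eq_imp_space_eq[OF sets_M] by simp
  have mult: "orthogonal_transformation (\<lambda>x. x * u)" "orthogonal_transformation (\<lambda>x. u * x)"
    if "norm u = 1" for u :: quat
    using that by (auto simp: orthogonal_transformation norm_mult algebra_simps intro!: linearI)
  have [measurable]: "(\<lambda>(x, u). u * x) \<in> measurable (M \<Otimes>\<^sub>M sphere_measure) sphere_measure"
  proof -
    have id: "(\<lambda>x. x) \<in> borel_measurable sphere_measure"
      unfolding measurable_cong_sets[OF sets_sphere_measure refl]
      by (rule measurable_restrict_space1) simp
    have idM: "(\<lambda>x. x) \<in> borel_measurable M"
      using id by (simp add: measurable_cong_sets[OF sets_M refl])
    have "(\<lambda>p. snd p * fst p) \<in> borel_measurable (M \<Otimes>\<^sub>M sphere_measure)"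
      by (intro borel_measurable_times measurable_compose[OF measurable_snd id]
          measurable_compose[OF measurable_fst idM])
    then have "(\<lambda>p. snd p * fst p) \<in> measurable (M \<Otimes>\<^sub>M sphere_measure) (restrict_space borel (sphere 0 1))"
      by (intro measurable_restrict_space2) (auto simp: space_pair_measure sp norm_mult)
    then show ?thesis
      by (simp add: measurable_cong_sets[OF refl sets_sphere_measure] case_prod_beta')
  qed
  let ?g = "\<lambda>x u. indicator A (u * x :: quat) :: ennreal"
  have [measurable]: "(\<lambda>(x, u). ?g x u) \<in> borel_measurable (M \<Otimes>\<^sub>M sphere_measure)"
    using A by measurable
  have 1: "(\<integral>\<^sup>+x. ?g x u \<partial>M) = emeasure M A" if "u \<in> space sphere_measure" for u
  proof -
    have u: "norm u = 1" using that by simp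
    have m: "(*) u \<in> measurable M M"
      using orthogonal_measurable_sphere[OF mult(2)[OF u]]
      by (simp add: measurable_cong_sets[OF sets_M sets_M])
    have "emeasure M A = (\<integral>\<^sup>+x. indicator A x \<partial>distr M M ((*) u))"
      using A by (simp add: inv[OF u] sets_M)
    also have "\<dots> = (\<integral>\<^sup>+x. ?g x u \<partial>M)"
      using m borel_measurable_indicator[of A M] A by (subst nn_integral_distr) (auto simp: sets_M)
    finally show ?thesis by simp
  qed
  have 2: "(\<integral>\<^sup>+u. ?g x u \<partial>sphere_measure) = emeasure sphere_measure A" if "x \<in> space M" for x
  proof -
    have x: "norm x = 1" using that by (simp add: sp)
    note m = orthogonal_measurable_sphere[OF mult(1)[OF x]]
    have "emeasure sphere_measure A =
        (\<integral>\<^sup>+u. indicator A u \<partial>distr sphere_measure sphere_measure (\<lambda>u. u * x))"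
      using A by (simp add: sphere_measure_rotation_invariant[OF mult(1)[OF x]])
    also have "\<dots> = (\<integral>\<^sup>+u. ?g x u \<partial>sphere_measure)"
      using A m by (subst nn_integral_distr) auto
    finally show ?thesis by simp
  qed
  have "emeasure M A = (\<integral>\<^sup>+u. (\<integral>\<^sup>+x. ?g x u \<partial>M) \<partial>sphere_measure)"
    by (simp add: 1 S.emeasure_space_1 cong: nn_integral_cong del: space_sphere_measure)
  also have "\<dots> = (\<integral>\<^sup>+x. (\<integral>\<^sup>+u. ?g x u \<partial>sphere_measure) \<partial>M)"
    by (rule P.Fubini') measurable
  also have "\<dots> = emeasure sphere_measure A"
    by (simp add: 2 M.emeasure_space_1 cong: nn_integral_cong)
  finally show "emeasure M A = emeasure sphere_measure A" .
qed (rule sets_M)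

end

theory Submission
  imports Defs "HOL-Complex_Analysis.Cauchy_Integral_Formula"
begin

text \<open>Put \<open>h = crf_op f\<close> and \<open>g = crf_op (\<lambda>x. x * f x)\<close>.  Holomorphy on the slice through \<open>x\<close> gives, by
  the Leibniz rule alone, \<open>f x = qcnj x * h x - g x\<close>.  Since \<open>h\<close> and \<open>g\<close> are locally constant on the
  spheres \<open>slice_sphere y\<close>, they depend near a nonreal point only on \<open>\<alpha> = qRe x\<close> and
  \<open>\<beta> = norm (qim x)\<close>.  Comparing two slices shows that the components of \<open>\<beta> h\<close> and \<open>\<beta> g\<close> are
  imaginary parts of holomorphic functions of \<open>\<alpha> + \<i> \<beta>\<close>, hence that \<open>h\<close> and \<open>g\<close> are harmonic off the
  real axis.  The real axis is a removable singularity for the maximum principle, so the continuous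
  functions \<open>h\<close> and \<open>g\<close> are given by their Poisson integrals.  Subtracting the two Poisson formulas
  from \<open>f = qcnj x * h - g\<close> gives the claim.\<close>

section \<open>The Laplacian as a limit of second differences\<close>

text \<open>The obstacle is regularity: \<open>f\<close> is only of class C^1, so \<open>h\<close>
  and \<open>g\<close> are a priori merely continuous. Smoothness is imported from one complex
  variable: the stem function of \<open>f\<close> over two slices is holomorphic, and
  \<open>h\<close> and \<open>g\<close> are recovered from it after division by \<beta>. That
  division loses the real axis, where only continuity of \<open>h\<close> and \<open>g\<close>
  remains.

  A second obstacle is that \<Omega> need not be axially symmetric. The conjugate of a slice point
  may lie outside \<Omega>, and \<open>slice_sphere y\<close> may meet \<Omega> in several
  components, on which \<open>h\<close> may take different values. The two units are therefore taken
  close together, so that both lifts lie in one small ball around the given point, and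
  \<open>h\<close> and \<open>g\<close> are constant on the caps that spheres cut out of this ball.

  The factor \<open>r\<close> in the result comes from \<open>qcnj (a + r \<zeta>) - qcnj (a + r x)
  = r (qcnj \<zeta> - qcnj x)\<close>.\<close>

text \<open>For twice continuously differentiable \<open>u\<close> this is the usual Laplacian; the limit of second differences only
  needs a dominated convergence argument to pass under the integral of the Poisson kernel.\<close>

definition has_laplacian :: "('a::euclidean_space \<Rightarrow> real) \<Rightarrow> 'a \<Rightarrow> real \<Rightarrow> bool" where
  "has_laplacian u x L \<longleftrightarrow>
     ((\<lambda>t. (\<Sum>b\<in>Basis. u (x + t *\<^sub>R b) + u (x - t *\<^sub>R b) - 2 * u x) / t\<^sup>2) \<longlongrightarrow> L) (at 0)"

lemma has_laplacian_add:
  assumes "has_laplacian u x L" "has_laplacian v x M"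
  shows "has_laplacian (\<lambda>y. u y + v y) x (L + M)"
  using tendsto_add[OF assms[unfolded has_laplacian_def]]
  by (simp add: has_laplacian_def sum.distrib sum_subtractf algebra_simps add_divide_distrib diff_divide_distrib)

lemma has_laplacian_cmult:
  assumes "has_laplacian u x L"
  shows "has_laplacian (\<lambda>y. c * u y) x (c * L)"
  using tendsto_mult_left[OF assms[unfolded has_laplacian_def], of c]
  by (simp add: has_laplacian_def sum_distrib_left algebra_simps)

lemma has_laplacian_const: "has_laplacian (\<lambda>y. c) x 0"
  by (simp add: has_laplacian_def)

lemma has_laplacian_diff:
  assumes "has_laplacian u x L" "has_laplacian v x M"
  shows "has_laplacian (\<lambda>y. u y - v y) x (L - M)"
  using has_laplacian_add[OF assms(1) has_laplacian_cmult[OF assms(2), of "-1"]] by simp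

lemma has_laplacian_translate:
  assumes "has_laplacian u (x + c) L"
  shows "has_laplacian (\<lambda>y. u (y + c)) x L"
  using assms by (simp add: has_laplacian_def algebra_simps)

lemma filterlim_mult_at_0:
  assumes "(r::real) \<noteq> 0"
  shows "filterlim (\<lambda>t. r * t) (at 0) (at 0)"
proof -
  have "((\<lambda>t. r * t) \<longlongrightarrow> r * 0) (at 0)"
    by (intro tendsto_intros)
  then show ?thesis
    using assms by (auto simp: filterlim_at eventually_at_filter)
qed

lemma has_laplacian_scale:
  assumes "has_laplacian u (a + r *\<^sub>R x) L" "r \<noteq> 0"
  shows "has_laplacian (\<lambda>y. u (a + r *\<^sub>R y)) x (r\<^sup>2 * L)"
proof -
  have "((\<lambda>t. r\<^sup>2 * ((\<Sum>b\<in>Basis. u (a + r *\<^sub>R x + (r * t) *\<^sub>R b) + u (a + r *\<^sub>R x - (r * t) *\<^sub>R b)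
      - 2 * u (a + r *\<^sub>R x)) / (r * t)\<^sup>2)) \<longlongrightarrow> r\<^sup>2 * L) (at 0)"
    using assms unfolding has_laplacian_def
    by (intro tendsto_mult_left) (rule filterlim_compose[OF _ filterlim_mult_at_0])
  then show ?thesis
    using assms(2) by (simp add: has_laplacian_def power_mult_distrib algebra_simps)
qed

lemma eventually_nhds_Basis_lines:
  fixes x :: "'a::euclidean_space"
  assumes "eventually P (nhds x)"
  shows "eventually (\<lambda>t. \<forall>b\<in>Basis. P (x + t *\<^sub>R b) \<and> P (x - t *\<^sub>R b)) (at (0::real))"
proof -
  have "eventually (\<lambda>t. P (x + t *\<^sub>R b) \<and> P (x - t *\<^sub>R b)) (at (0::real))" for b
  proof -
    have "((\<lambda>t::real. x + t *\<^sub>R b) \<longlongrightarrow> x + 0 *\<^sub>R b) (at 0)" "((\<lambda>t::real. x - t *\<^sub>R b) \<longlongrightarrow> x - 0 *\<^sub>R b) (at 0)"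
      by (intro tendsto_intros)+
    then have "filterlim (\<lambda>t::real. x + t *\<^sub>R b) (nhds x) (at 0)" "filterlim (\<lambda>t::real. x - t *\<^sub>R b) (nhds x) (at 0)"
      by simp_all
    from this[THEN eventually_compose_filterlim[OF assms]] show ?thesis
      by (rule eventually_conj)
  qed
  then show ?thesis
    by (simp add: eventually_ball_finite_distrib)
qed

lemma has_laplacian_cong:
  assumes "has_laplacian u x L" "eventually (\<lambda>y. u y = v y) (nhds x)"
  shows "has_laplacian v x L"
proof -
  have "u x = v x"
    using assms(2) by (rule eventually_nhds_x_imp_x)
  then have "eventually (\<lambda>t. (\<Sum>b\<in>Basis. u (x + t *\<^sub>R b) + u (x - t *\<^sub>R b) - 2 * u x) / t\<^sup>2 =
      (\<Sum>b\<in>Basis. v (x + t *\<^sub>R b) + v (x - t *\<^sub>R b) - 2 * v x) / t\<^sup>2) (at 0)"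
    using eventually_nhds_Basis_lines[OF assms(2)] by (auto elim!: eventually_mono intro!: sum.cong)
  then show ?thesis
    unfolding has_laplacian_def
    by (rule Lim_transform_eventually[OF assms(1)[unfolded has_laplacian_def]])
qed

text \<open>One application of l'Hopital leaves \<open>(g' t - g' (- t)) / (2 * t)\<close>, the mean
  of the difference quotients of \<open>g'\<close> at 0 for the increments \<open>t\<close> and
  \<open>- t\<close>.\<close>

lemma second_difference_tendsto:
  fixes g g' :: "real \<Rightarrow> real"
  assumes g: "eventually (\<lambda>t. (g has_real_derivative g' t) (at t)) (nhds 0)"
    and g': "(g' has_real_derivative c) (at 0)"
  shows "((\<lambda>t. (g t + g (- t) - 2 * g 0) / t\<^sup>2) \<longlongrightarrow> c) (at 0)"
proof (rule lhopital)
  have neg: "filterlim (\<lambda>t::real. - t) (nhds 0) (nhds 0)"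
    using tendsto_minus[OF tendsto_ident_at[of "0::real" UNIV]]
    by (simp add: filterlim_def filtermap_nhds_minus)
  have neg': "filterlim (\<lambda>t::real. - t) (at 0) (at 0)"
    using filterlim_mult_at_0[of "-1"] by simp
  have cont: "isCont g 0"
    using eventually_nhds_x_imp_x[OF g] by (rule DERIV_isCont)
  then have "(g \<longlongrightarrow> g 0) (at 0)"
    by (simp add: isCont_def)
  from tendsto_add[OF this filterlim_compose[OF this neg']]
  show "((\<lambda>t. g t + g (- t) - 2 * g 0) \<longlongrightarrow> 0) (at 0)"
    using tendsto_diff[OF _ tendsto_const[of "2 * g 0"]] by fastforce
  have "((\<lambda>t::real. t\<^sup>2) \<longlongrightarrow> 0\<^sup>2) (at 0)"
    by (intro tendsto_intros)
  then show "((\<lambda>t::real. t\<^sup>2) \<longlongrightarrow> 0) (at 0)" by simp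
  show "eventually (\<lambda>t::real. t\<^sup>2 \<noteq> 0) (at 0)" "eventually (\<lambda>t::real. 2 * t \<noteq> 0) (at 0)"
    by (auto simp: eventually_at_filter)
  have "eventually (\<lambda>t. (g has_real_derivative g' t) (at t) \<and> (g has_real_derivative g' (- t)) (at (- t))) (nhds 0)"
    using g eventually_compose_filterlim[OF g neg] by eventually_elim simp
  then have "eventually (\<lambda>t. ((\<lambda>t. g t + g (- t) - 2 * g 0) has_real_derivative g' t - g' (- t)) (at t)) (nhds 0)"
  proof eventually_elim
    case (elim t)
    then have "((\<lambda>t. g (- t)) has_real_derivative g' (- t) * - 1) (at t)"
      by (intro DERIV_chain2[of g]) (auto intro!: derivative_eq_intros)
    with elim show ?case
      by (auto intro!: derivative_eq_intros)
  qed
  then show "eventually (\<lambda>t. ((\<lambda>t. g t + g (- t) - 2 * g 0) has_real_derivative g' t - g' (- t)) (at t)) (at 0)"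
    by (simp add: eventually_nhds_conv_at)
  show "eventually (\<lambda>t. ((\<lambda>t::real. t\<^sup>2) has_real_derivative 2 * t) (at t)) (at 0)"
    by (auto intro!: always_eventually derivative_eq_intros)
  have 1: "((\<lambda>t. (g' t - g' 0) / t) \<longlongrightarrow> c) (at 0)"
    using g' by (simp add: has_field_derivative_iff)
  have "((\<lambda>t. (1/2) * ((g' t - g' 0) / t + (g' (- t) - g' 0) / (- t))) \<longlongrightarrow> (1/2) * (c + c)) (at 0)"
    by (intro tendsto_mult_left tendsto_add 1 filterlim_compose[OF 1 neg'])
  then have "((\<lambda>t. (g' t - g' (- t)) / (2 * t)) \<longlongrightarrow> (1/2) * (c + c)) (at 0)"
    by (rule Lim_transform_eventually) (auto simp: eventually_at_filter field_simps)
  then show "((\<lambda>t. (g' t - g' (- t)) / (2 * t)) \<longlongrightarrow> c) (at 0)"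
    by simp
qed

lemma has_laplacianI:
  assumes "\<And>b. b \<in> Basis \<Longrightarrow> eventually (\<lambda>t. ((\<lambda>t. u (x + t *\<^sub>R b)) has_real_derivative d b t) (at t)) (nhds 0)"
    and "\<And>b. b \<in> Basis \<Longrightarrow> (d b has_real_derivative c b) (at 0)"
  shows "has_laplacian u x (\<Sum>b\<in>Basis. c b)"
  unfolding has_laplacian_def sum_divide_distrib
  by (intro tendsto_sum) (use second_difference_tendsto[OF assms] in simp)

lemma has_laplacian_local_max:
  assumes "has_laplacian u x L" "eventually (\<lambda>y. u y \<le> u x) (nhds x)"
  shows "L \<le> 0"
proof -
  have "eventually (\<lambda>t. \<forall>b\<in>Basis. u (x + t *\<^sub>R b) + u (x - t *\<^sub>R b) - 2 * u x \<le> 0) (at (0::real))"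
    using eventually_nhds_Basis_lines[OF assms(2)] by eventually_elim fastforce
  then have "eventually (\<lambda>t. (\<Sum>b\<in>Basis. u (x + t *\<^sub>R b) + u (x - t *\<^sub>R b) - 2 * u x) / t\<^sup>2 \<le> 0) (at (0::real))"
    by eventually_elim (auto intro!: divide_nonpos_nonneg sum_nonpos)
  then show ?thesis
    using assms(1) unfolding has_laplacian_def by (intro tendsto_upperbound) auto
qed

text \<open>By the parallelogram law each second difference equals \<open>2 * t\<^sup>2\<close>
  exactly. This is the strictly subharmonic perturbation in the maximum principle.\<close>

lemma has_laplacian_norm_sq:
  fixes a x :: "'a::euclidean_space"
  shows "has_laplacian (\<lambda>y. (norm (y - a))\<^sup>2) x (2 * DIM('a))"
proof -
  have "(\<Sum>b\<in>Basis. (norm (x + t *\<^sub>R b - a))\<^sup>2 + (norm (x - t *\<^sub>R b - a))\<^sup>2 - 2 * (norm (x - a))\<^sup>2) / t\<^sup>2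
      = 2 * DIM('a)" if "t \<noteq> 0" for t :: real
  proof -
    have "(norm (x + t *\<^sub>R b - a))\<^sup>2 + (norm (x - t *\<^sub>R b - a))\<^sup>2 - 2 * (norm (x - a))\<^sup>2 = 2 * t\<^sup>2"
      if "b \<in> Basis" for b
      using that unfolding power2_norm_eq_inner
      by (simp add: inner_simps inner_commute algebra_simps) (simp add: power2_eq_square)
    then show ?thesis using that by (simp add: field_simps)
  qed
  then have "eventually (\<lambda>t. 2 * DIM('a) = (\<Sum>b\<in>Basis. (norm (x + t *\<^sub>R b - a))\<^sup>2
      + (norm (x - t *\<^sub>R b - a))\<^sup>2 - 2 * (norm (x - a))\<^sup>2) / t\<^sup>2) (at (0::real))"
    by (auto simp: eventually_at_filter)
  then show ?thesis
    unfolding has_laplacian_def by (rule Lim_transform_eventually[OF tendsto_const])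
qed

section \<open>Axially symmetric harmonic functions\<close>

lemma of_real_quat_sel [simp]:
  "qRe (of_real t) = t" "qI (of_real t) = 0" "qJ (of_real t) = 0" "qK (of_real t) = 0"
  by (simp_all add: of_real_def)

definition qim :: "quat \<Rightarrow> quat" where
  "qim x = x - of_real (qRe x)"

lemma qim_sel [simp]: "qRe (qim x) = 0" "qI (qim x) = qI x" "qJ (qim x) = qJ x" "qK (qim x) = qK x"
  by (simp_all add: qim_def of_real_def)

lemma qim_simps: "qim (x + y) = qim x + qim y" "qim (x - y) = qim x - qim y" "qim (t *\<^sub>R x) = t *\<^sub>R qim x"
  by (simp_all add: quat_eq_iff)

lemma bounded_linear_qRe: "bounded_linear qRe" and bounded_linear_qim: "bounded_linear qim"
  by (auto intro!: linearI linear_linear[THEN iffD2] simp: quat_eq_iff linear_conv_bounded_linear[symmetric])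

lemmas qRe_continuous_on [continuous_intros] = bounded_linear.continuous_on[OF bounded_linear_qRe]
lemmas qim_continuous_on [continuous_intros] = bounded_linear.continuous_on[OF bounded_linear_qim]

text \<open>A function \<open>q(\<alpha>, \<beta>)\<close> of \<open>\<alpha> = qRe y\<close> and \<open>\<beta> = norm (qim y)\<close> has Laplacian
  \<open>q\<^sub>\<alpha>\<^sub>\<alpha> + q\<^sub>\<beta>\<^sub>\<beta> + (2 / \<beta>) q\<^sub>\<beta>\<close>, which is \<open>1 / \<beta>\<close> times the planar Laplacian of \<open>\<beta> q\<close>.\<close>

lemma has_laplacian_axial:
  assumes F: "F holomorphic_on U" and U: "open U" "Complex (qRe x) (norm (qim x)) \<in> U" and x: "qim x \<noteq> 0"
  shows "has_laplacian (\<lambda>y. Im (F (Complex (qRe y) (norm (qim y)))) / norm (qim y)) x 0"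
proof -
  define \<alpha> \<beta> where "\<alpha> = qRe x" and "\<beta> = norm (qim x)"
  have \<beta>: "\<beta> > 0" using x by (simp add: \<beta>_def)
  have zU: "Complex \<alpha> \<beta> \<in> U" using U by (simp add: \<alpha>_def \<beta>_def)
  have DF: "(F has_field_derivative deriv F z) (at z)" "(deriv F has_field_derivative deriv (deriv F) z) (at z)"
    if "z \<in> U" for z
    using that F U(1) by (auto intro!: holomorphic_derivI holomorphic_deriv)
  have im: "((\<lambda>s. Im (G (\<gamma> s))) has_real_derivative Im (v * G')) (at s)"
    if "(\<gamma> has_vector_derivative v) (at s)" "(G has_field_derivative G') (at (\<gamma> s))"
    for G \<gamma> v G' s
    using bounded_linear.has_vector_derivative[OF bounded_linear_Im field_vector_diff_chain_at[OF that]]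
    by (simp add: has_real_derivative_iff_has_vector_derivative o_def)
  have "Complex \<alpha> = (\<lambda>s. of_real \<alpha> + s *\<^sub>R \<i>)"
    by (auto simp: complex_eq_iff)
  then have vert: "(Complex \<alpha> has_vector_derivative \<i>) (at s)" for s
    by (auto intro!: derivative_eq_intros)
  have "(\<lambda>s. Complex (\<alpha> + s) \<beta>) = (\<lambda>s. Complex \<alpha> \<beta> + s *\<^sub>R 1)"
    by (auto simp: complex_eq_iff)
  then have hor: "((\<lambda>s. Complex (\<alpha> + s) \<beta>) has_vector_derivative 1) (at s)" for s
    by (auto intro!: derivative_eq_intros)
  define p where "p = (\<lambda>s. Im (F (Complex \<alpha> s)))"
  define p1 where "p1 = (\<lambda>s. Im (\<i> * deriv F (Complex \<alpha> s)))"
  \<comment> \<open>Two vertical derivatives bring in the factor \<i> twice, so \<open>p2\<close> is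
    minus the imaginary part of the second derivative of \<open>F\<close>. This will cancel the
    contribution of the real direction.\<close>
  define p2 where "p2 = Im (\<i> * (deriv (deriv F) (Complex \<alpha> \<beta>) * \<i>))"
  have p: "(p has_real_derivative p1 s) (at s)" if "Complex \<alpha> s \<in> U" for s
    unfolding p_def p1_def by (intro im vert DF that)
  have p1: "(p1 has_real_derivative p2) (at \<beta>)"
    using im[OF vert DERIV_cmult[OF DF(2)[OF zU], of \<i>]]
    unfolding p1_def p2_def by (simp add: mult_ac)
  define q where "q = (\<lambda>s. p s / s)"
  define q1 where "q1 = (\<lambda>s. p1 s / s - p s / s\<^sup>2)"
  define q2 where "q2 = p2 / \<beta> - 2 * p1 \<beta> / \<beta>\<^sup>2 + 2 * p \<beta> / \<beta> ^ 3"
  have q: "(q has_real_derivative q1 s) (at s)" if "Complex \<alpha> s \<in> U" "s > 0" for s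
    unfolding q_def q1_def using that
    by (auto intro!: derivative_eq_intros p simp: field_simps power2_eq_square)
  have q1: "(q1 has_real_derivative q2) (at \<beta>)"
    unfolding q1_def q2_def using \<beta> zU
    by (auto intro!: derivative_eq_intros p p1
       simp: field_simps power2_eq_square power3_eq_cube)
  \<comment> \<open>The radius along the line through \<open>x\<close> in an imaginary direction;
    its square is a quadratic polynomial in \<open>t\<close>.\<close>
  define \<gamma> where "\<gamma> = (\<lambda>b t. norm (qim x + t *\<^sub>R b))"
  have \<gamma>0: "\<gamma> b 0 = \<beta>" for b
    by (simp add: \<gamma>_def \<beta>_def)
  have D\<gamma>: "(\<gamma> b has_real_derivative (qim x \<bullet> b + t) / \<gamma> b t) (at t)"
    if "\<gamma> b t > 0" "norm b = 1" for b t
  proof -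
    have eq: "\<gamma> b = (\<lambda>t. sqrt (\<beta>\<^sup>2 + 2 * t * (qim x \<bullet> b) + t\<^sup>2))"
      using that(2) unfolding \<gamma>_def \<beta>_def norm_eq_sqrt_inner[of "qim x + _"] power2_norm_eq_inner
      by (intro ext arg_cong[of _ _ sqrt])
        (simp add: inner_simps inner_commute norm_eq_1 algebra_simps power2_eq_square)
    show ?thesis
      using that(1) unfolding eq
      by (auto intro!: derivative_eq_intros simp: field_simps)
  qed
  have op: "open {s. Complex \<alpha> s \<in> U \<and> s > 0}"
  proof -
    have "continuous_on UNIV (Complex \<alpha>)"
      using vert by (auto intro!: continuous_at_imp_continuous_on has_vector_derivative_continuous)
    then have "open ((Complex \<alpha> -` U) \<inter> {0<..})"
      using U(1) by (intro open_Int open_vimage) auto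
    then show ?thesis by (simp add: vimage_def greaterThan_def Int_def)
  qed
  have op1: "open {s. Complex (\<alpha> + s) \<beta> \<in> U}"
  proof -
    have "continuous_on UNIV (\<lambda>s. Complex (\<alpha> + s) \<beta>)"
      using hor by (auto intro!: continuous_at_imp_continuous_on has_vector_derivative_continuous)
    then show ?thesis
      using open_vimage[OF U(1)] by (simp add: vimage_def)
  qed
  define d where "d = (\<lambda>b t. if b = 1 then Im (deriv F (Complex (\<alpha> + t) \<beta>)) / \<beta>
     else q1 (\<gamma> b t) * ((qim x \<bullet> b + t) / \<gamma> b t))"
  \<comment> \<open>For imaginary \<open>b\<close> this is the second-order chain rule for
    \<open>q (\<gamma> b t)\<close>: the first derivative of \<open>\<gamma> b\<close> at 0 is
    \<open>qim x \<bullet> b / \<beta>\<close>, the second one is the factor of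
    \<open>q1 \<beta>\<close>.\<close>
  define c where "c = (\<lambda>b. if b = 1 then Im (deriv (deriv F) (Complex \<alpha> \<beta>)) / \<beta>
     else q2 * (qim x \<bullet> b / \<beta>)\<^sup>2 + q1 \<beta> * (1 / \<beta> - (qim x \<bullet> b)\<^sup>2 / \<beta> ^ 3))"
  have "has_laplacian (\<lambda>y. Im (F (Complex (qRe y) (norm (qim y)))) / norm (qim y)) x (\<Sum>b\<in>Basis. c b)"
  proof (rule has_laplacianI)
    fix b :: quat assume b: "b \<in> Basis"
    show "\<forall>\<^sub>F t in nhds 0. ((\<lambda>t. Im (F (Complex (qRe (x + t *\<^sub>R b)) (norm (qim (x + t *\<^sub>R b))))) /
        norm (qim (x + t *\<^sub>R b))) has_real_derivative d b t) (at t)"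
    proof (cases "b = 1")
      case True
      then have *: "(\<lambda>t. Im (F (Complex (qRe (x + t *\<^sub>R b)) (norm (qim (x + t *\<^sub>R b))))) /
        norm (qim (x + t *\<^sub>R b))) = (\<lambda>t. Im (F (Complex (\<alpha> + t) \<beta>)) / \<beta>)"
        by (simp add: \<alpha>_def \<beta>_def qim_def of_real_def algebra_simps)
      have "eventually (\<lambda>t. Complex (\<alpha> + t) \<beta> \<in> U) (nhds 0)"
        using eventually_nhds_in_open[OF op1, of 0] zU by simp
      then show ?thesis
        unfolding * d_def
        by eventually_elim (use True in \<open>auto intro!: DERIV_cdivide im[OF hor DF(1), simplified]\<close>)
    next
      case False
      then have b': "qim b = b" "qRe b = 0" "norm b = 1"
        using b by (auto simp: Basis_quat_eq quat_i_def quat_j_def quat_k_def quat_eq_iff norm_quat_def)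
      have *: "(\<lambda>t. Im (F (Complex (qRe (x + t *\<^sub>R b)) (norm (qim (x + t *\<^sub>R b))))) /
        norm (qim (x + t *\<^sub>R b))) = (\<lambda>t. q (\<gamma> b t))"
        by (simp add: q_def p_def \<gamma>_def qim_simps b' \<alpha>_def)
      have "isCont (\<gamma> b) 0"
        using D\<gamma>[of b 0] \<gamma>0 \<beta> b' by (auto intro!: DERIV_isCont)
      then have "(\<gamma> b \<longlongrightarrow> \<gamma> b 0) (nhds 0)"
        by (simp only: isCont_def tendsto_at_iff_tendsto_nhds)
      then have "eventually (\<lambda>t. Complex \<alpha> (\<gamma> b t) \<in> U \<and> \<gamma> b t > 0) (nhds 0)"
        using topological_tendstoD[OF _ op] zU \<beta> \<gamma>0 by fastforce
      then show ?thesis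
        unfolding * d_def
        by eventually_elim (use False b' in \<open>auto intro!: DERIV_chain2[OF q] D\<gamma> simp del: times_divide_eq_right\<close>)
    qed
    show "(d b has_real_derivative c b) (at 0)"
    proof (cases "b = 1")
      case True
      then show ?thesis
        using DERIV_cdivide[OF im[OF hor[of 0], of "deriv F"], of _ \<beta>] DF(2)[OF zU]
        unfolding d_def c_def by simp
    next
      case False
      then have b': "norm b = 1" using b by simp
      have 1: "(\<gamma> b has_real_derivative (qim x \<bullet> b) / \<beta>) (at 0)"
        using D\<gamma>[of b 0] \<gamma>0 \<beta> b' by auto
      have 2: "((\<lambda>t. q1 (\<gamma> b t)) has_real_derivative q2 * (qim x \<bullet> b / \<beta>)) (at 0)"
        using q1 1 \<gamma>0 by (intro DERIV_chain2[of q1]) auto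
      have "((\<lambda>t. qim x \<bullet> b + t) has_real_derivative 1) (at 0)"
        by (auto intro!: derivative_eq_intros)
      from DERIV_mult[OF 2 DERIV_divide[OF this 1]]
      have "(d b has_real_derivative q2 * (qim x \<bullet> b / \<beta>) * (qim x \<bullet> b / \<beta>)
          + (\<beta> - qim x \<bullet> b * (qim x \<bullet> b / \<beta>)) / (\<beta> * \<beta>) * q1 \<beta>) (at 0)"
        using False \<beta> by (simp add: d_def \<gamma>0)
      moreover have "q2 * (qim x \<bullet> b / \<beta>) * (qim x \<bullet> b / \<beta>)
          + (\<beta> - qim x \<bullet> b * (qim x \<bullet> b / \<beta>)) / (\<beta> * \<beta>) * q1 \<beta> = c b"
        using False \<beta> by (simp add: c_def field_simps power2_eq_square power3_eq_cube)
      ultimately show ?thesis by simp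
    qed
  qed
  \<comment> \<open>The three imaginary directions contribute \<open>3 / \<beta>\<close> to the
    factor of \<open>q1 \<beta>\<close>, and the squared coordinates take \<open>1 / \<beta>\<close>
    away: the first-order coefficient of the radial Laplacian in dimension 3 remains.\<close>
  also have "(\<Sum>b\<in>Basis. c b) = Im (deriv (deriv F) (Complex \<alpha> \<beta>)) / \<beta>
      + q2 * (((qI x)\<^sup>2 + (qJ x)\<^sup>2 + (qK x)\<^sup>2) / \<beta>\<^sup>2)
      + q1 \<beta> * (3 / \<beta> - ((qI x)\<^sup>2 + (qJ x)\<^sup>2 + (qK x)\<^sup>2) / \<beta> ^ 3)"
  proof -
    have "(\<Sum>b\<in>Basis. c b) = c 1 + c quat_i + c quat_j + c quat_k"
      by (simp add: Basis_quat_eq quat_i_def quat_j_def quat_k_def quat_eq_iff)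
    moreover have "qim x \<bullet> quat_i = qI x" "qim x \<bullet> quat_j = qJ x" "qim x \<bullet> quat_k = qK x"
      "quat_i \<noteq> 1" "quat_j \<noteq> 1" "quat_k \<noteq> 1"
      by (simp_all add: quat_i_def quat_j_def quat_k_def quat_eq_iff inner_quat_def)
    ultimately have "(\<Sum>b\<in>Basis. c b) = Im (deriv (deriv F) (Complex \<alpha> \<beta>)) / \<beta>
      + q2 * ((qI x / \<beta>)\<^sup>2 + (qJ x / \<beta>)\<^sup>2 + (qK x / \<beta>)\<^sup>2)
      + q1 \<beta> * (3 / \<beta> - ((qI x)\<^sup>2 / \<beta> ^ 3 + (qJ x)\<^sup>2 / \<beta> ^ 3 + (qK x)\<^sup>2 / \<beta> ^ 3))"
      unfolding c_def by (simp add: algebra_simps)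
    then show ?thesis
      by (simp only: power_divide add_divide_distrib)
  qed
  also have "(qI x)\<^sup>2 + (qJ x)\<^sup>2 + (qK x)\<^sup>2 = \<beta>\<^sup>2"
    by (simp add: \<beta>_def norm_quat_sq)
  also have "Im (deriv (deriv F) (Complex \<alpha> \<beta>)) / \<beta> + q2 * (\<beta>\<^sup>2 / \<beta>\<^sup>2) + q1 \<beta> * (3 / \<beta> - \<beta>\<^sup>2 / \<beta> ^ 3) = 0"
  proof -
    have "p2 = - Im (deriv (deriv F) (Complex \<alpha> \<beta>))"
      by (simp add: p2_def)
    moreover have "q2 = p2 / \<beta> - q1 \<beta> * (2 / \<beta>)"
      using \<beta> by (simp add: q2_def q1_def field_simps power2_eq_square power3_eq_cube)
    moreover have "\<beta>\<^sup>2 / \<beta>\<^sup>2 = 1" "\<beta>\<^sup>2 / \<beta> ^ 3 = 1 / \<beta>"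
      using \<beta> by (simp_all add: power2_eq_square power3_eq_cube)
    ultimately show ?thesis
      by (simp add: algebra_simps)
  qed
  finally show ?thesis .
qed

section \<open>The maximum principle\<close>

text \<open>The Newtonian kernel of the three imaginary coordinates, constant in the real one. It is
  the axial function of the constant holomorphic function \<i>, translated by
  \<open>c\<close>.\<close>

lemma has_laplacian_barrier:
  assumes "qim x \<noteq> c" "qRe c = 0"
  shows "has_laplacian (\<lambda>y. 1 / norm (qim y - c)) x 0"
proof -
  have c: "qim c = c"
    using assms(2) by (simp add: quat_eq_iff)
  have "has_laplacian (\<lambda>y. Im ((\<lambda>z. \<i>) (Complex (qRe y) (norm (qim y)))) / norm (qim y)) (x + - c) 0"
    using assms c by (intro has_laplacian_axial[of _ UNIV]) (auto simp: qim_simps)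
  from has_laplacian_translate[OF this] show ?thesis
    by (simp add: qim_simps c)
qed

text \<open>The line \<open>qim x = c\<close> is a removable singularity: the harmonic barrier \<open>1 / norm (qim y - c)\<close>
  is infinite on it.\<close>

lemma maximum_principle:
  fixes w :: "quat \<Rightarrow> real"
  assumes cont: "continuous_on (cball a \<rho>) w"
    and bd: "\<And>x. x \<in> sphere a \<rho> \<Longrightarrow> w x \<le> 0"
    and lap: "\<And>x. x \<in> ball a \<rho> \<Longrightarrow> qim x \<noteq> c \<Longrightarrow> has_laplacian w x 0"
    and c: "qRe c = 0" and x: "x \<in> ball a \<rho>"
  shows "w x \<le> 0"
proof -
  have off: "w x \<le> 0" if x: "x \<in> ball a \<rho>" "qim x \<noteq> c" for x
  proof (rule ccontr)
    assume "\<not> w x \<le> 0"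
    then have pos: "w x > 0" by simp
    have \<rho>: "\<rho> > 0" using x(1) by (metis ball_eq_empty empty_iff not_le)
    have "bounded (w ` cball a \<rho>)"
      using cont by (intro compact_imp_bounded compact_continuous_image) auto
    then obtain M where M: "\<And>y. y \<in> cball a \<rho> \<Longrightarrow> \<bar>w y\<bar> \<le> M"
      unfolding bounded_iff real_norm_def by blast
    define d where "d = norm (qim x - c)"
    have d: "d > 0" using x by (simp add: d_def)
    \<comment> \<open>The constants split the height \<open>w x\<close>: on the ball the quadratic
      term adds at most a quarter of it, and at \<open>x\<close> the barrier takes away half of it.
      Hence \<open>v x \<ge> w x / 2\<close>, and \<open>w\<close> is positive wherever
      \<open>v\<close> exceeds \<open>w x / 4\<close>.\<close>
    define \<delta> where "\<delta> = w x / (4 * \<rho>\<^sup>2)"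
    define \<epsilon> where "\<epsilon> = w x * d / 2"
    have \<delta>: "\<delta> > 0" "\<delta> * \<rho>\<^sup>2 = w x / 4" and \<epsilon>: "\<epsilon> > 0" "\<epsilon> / d = w x / 2"
      using pos \<rho> d by (simp_all add: \<delta>_def \<epsilon>_def)
    \<comment> \<open>The radius of a tube around the exceptional line. On the boundary of the tube
      the barrier term is at least \<open>\<bar>M\<bar> + \<delta> * \<rho>\<^sup>2\<close> and
      forces \<open>v \<le> 0\<close>; the bound \<open>d\<close> keeps \<open>x\<close> in the
      remaining compact set \<open>K\<close>.\<close>
    define \<eta> where "\<eta> = min d (\<epsilon> / (\<bar>M\<bar> + \<delta> * \<rho>\<^sup>2 + 1))"
    have den: "\<bar>M\<bar> + \<delta> * \<rho>\<^sup>2 + 1 > 0"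
      using \<delta>(1) by (intro add_nonneg_pos add_nonneg_nonneg) auto
    then have \<eta>: "\<eta> > 0" "\<eta> \<le> d" using d \<epsilon> by (auto simp: \<eta>_def)
    have "\<eta> * (\<bar>M\<bar> + \<delta> * \<rho>\<^sup>2 + 1) \<le> \<epsilon>"
      using den by (simp add: \<eta>_def pos_le_divide_eq[symmetric])
    then have \<eta>M: "\<bar>M\<bar> + \<delta> * \<rho>\<^sup>2 \<le> \<epsilon> / \<eta>"
      using \<eta> by (simp add: field_simps)
    define v where "v = (\<lambda>y. w y + \<delta> * (norm (y - a))\<^sup>2 - \<epsilon> * (1 / norm (qim y - c)))"
    define K where "K = {y \<in> cball a \<rho>. \<eta> \<le> norm (qim y - c)}"
    have "K = cball a \<rho> \<inter> {y. \<eta> \<le> norm (qim y - c)}"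
      by (auto simp: K_def)
    moreover have "closed {y. \<eta> \<le> norm (qim y - c)}"
      by (intro closed_Collect_le continuous_intros)
    ultimately have "compact K"
      by (simp add: compact_Int_closed)
    moreover have xK: "x \<in> K"
      using x \<eta> by (simp add: K_def d_def)
    moreover have "continuous_on K v"
      unfolding v_def K_def using \<eta>
      by (intro continuous_intros continuous_on_subset[OF cont]) auto
    ultimately obtain m where m: "m \<in> K" "\<And>y. y \<in> K \<Longrightarrow> v y \<le> v m"
      using continuous_attains_sup[of K v] by blast
    have vx: "v x \<ge> w x / 2"
      using \<epsilon>(2) \<delta>(1) by (simp add: v_def d_def)
    have sq: "\<delta> * (norm (m - a))\<^sup>2 \<le> \<delta> * \<rho>\<^sup>2"
      using m(1) \<delta>(1) by (intro mult_left_mono power_mono) (auto simp: K_def dist_norm norm_minus_commute)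
    have "v m \<le> w m + \<delta> * \<rho>\<^sup>2"
      using add_mono[OF sq divide_nonneg_nonneg[OF less_imp_le[OF \<epsilon>(1)] norm_ge_zero[of "qim m - c"]]]
      by (simp add: v_def)
    moreover have "v m > w x / 4"
      using vx m(2)[OF xK] pos by linarith
    ultimately have "w m > 0"
      using \<delta>(2) by linarith
    then have mb: "m \<in> ball a \<rho>"
      using m(1) bd[of m] by (force simp: K_def)
    have "norm (qim m - c) \<noteq> \<eta>"
    proof
      assume eq: "norm (qim m - c) = \<eta>"
      have "w m \<le> \<bar>M\<bar>" using M[of m] m(1) by (auto simp: K_def)
      then have "v m \<le> 0" using sq \<eta>M by (simp add: v_def eq)
      then show False using vx m(2)[OF xK] pos by linarith
    qed
    then have mo: "\<eta> < norm (qim m - c)"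
      using m(1) by (simp add: K_def)
    \<comment> \<open>The maximum lies neither on the sphere nor on the tube, so it is an interior
      local maximum, although the Laplacian of \<open>v\<close> there is positive.\<close>
    have "has_laplacian v m (0 + \<delta> * (2 * DIM(quat)) - \<epsilon> * 0)"
      unfolding v_def using mo \<eta>(1) c mb
      by (intro has_laplacian_diff has_laplacian_add has_laplacian_cmult has_laplacian_norm_sq
          has_laplacian_barrier lap) auto
    moreover have "eventually (\<lambda>y. v y \<le> v m) (nhds m)"
    proof -
      have "open (ball a \<rho> \<inter> {y. \<eta> < norm (qim y - c)})"
        by (intro open_Int open_ball open_Collect_less continuous_intros)
      then have "eventually (\<lambda>y. y \<in> ball a \<rho> \<inter> {y. \<eta> < norm (qim y - c)}) (nhds m)"
        using mo mb by (intro eventually_nhds_in_open) auto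
      then show ?thesis
        by eventually_elim (auto intro!: m(2) simp: K_def)
    qed
    ultimately have "\<delta> * (2 * DIM(quat)) \<le> 0"
      using has_laplacian_local_max by fastforce
    then show False
      using \<delta>(1) DIM_positive[where 'a=quat] by (simp add: mult_le_0_iff)
  qed
  show ?thesis
  proof (cases "qim x = c")
    case True
    \<comment> \<open>The direction \<open>quat_i\<close> leaves the line at once, so
      \<open>w x\<close> is a limit of values that are already bounded by 0.\<close>
    have "((\<lambda>t. x + t *\<^sub>R quat_i) \<longlongrightarrow> x + 0 *\<^sub>R quat_i) (at_right 0)"
      by (intro tendsto_intros)
    then have lim: "((\<lambda>t. x + t *\<^sub>R quat_i) \<longlongrightarrow> x) (at_right 0)"
      by simp
    then have ev: "eventually (\<lambda>t. x + t *\<^sub>R quat_i \<in> ball a \<rho>) (at_right 0)"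
      using assms(5) by (rule topological_tendstoD[OF _ open_ball])
    have "eventually (\<lambda>t::real. t > 0) (at_right 0)"
      by (rule eventually_at_right_less)
    with ev have "eventually (\<lambda>t. w (x + t *\<^sub>R quat_i) \<le> 0) (at_right 0)"
    proof eventually_elim
      case (elim t)
      have "qim (x + t *\<^sub>R quat_i) - c = t *\<^sub>R quat_i"
        using True by (simp add: qim_simps) (simp add: quat_eq_iff quat_i_def)
      then have "qim (x + t *\<^sub>R quat_i) \<noteq> c"
        using elim by (auto simp: quat_i_def quat_eq_iff)
      then show ?case using elim off by blast
    qed
    moreover have "isCont w x"
      using assms(5) cont by (intro continuous_on_interior[of "cball a \<rho>"]) auto
    then have "((\<lambda>t. w (x + t *\<^sub>R quat_i)) \<longlongrightarrow> w x) (at_right 0)"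
      using lim by (rule isCont_tendsto_compose)
    ultimately show ?thesis
      by (intro tendsto_upperbound) auto
  qed (use assms(5) off in blast)
qed

lemma comparison_principle:
  fixes u v :: "quat \<Rightarrow> real"
  assumes "continuous_on (cball a \<rho>) u" "continuous_on (cball a \<rho>) v"
    and "\<And>x. x \<in> sphere a \<rho> \<Longrightarrow> u x = v x"
    and "\<And>x. x \<in> ball a \<rho> \<Longrightarrow> qim x \<noteq> c \<Longrightarrow> has_laplacian u x 0"
    and "\<And>x. x \<in> ball a \<rho> \<Longrightarrow> qim x \<noteq> c \<Longrightarrow> has_laplacian v x 0"
    and "qRe c = 0" "x \<in> ball a \<rho>"
  shows "u x = v x"
proof (rule antisym)
  have "has_laplacian (\<lambda>y. u y - v y) x 0" "has_laplacian (\<lambda>y. v y - u y) x 0"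
    if "x \<in> ball a \<rho>" "qim x \<noteq> c" for x
    using has_laplacian_diff[OF assms(4)[OF that] assms(5)[OF that]]
      has_laplacian_diff[OF assms(5)[OF that] assms(4)[OF that]] by simp_all
  note lap = this
  show "u x \<le> v x"
    using maximum_principle[OF continuous_on_diff[OF assms(1,2)] _ lap(1) assms(6,7)] assms(3) by simp
  show "v x \<le> u x"
    using maximum_principle[OF continuous_on_diff[OF assms(2,1)] _ lap(2) assms(6,7)] assms(3) by simp
qed

section \<open>The Poisson integral\<close>

text \<open>Sequences detect the limit, and the usual dominated convergence theorem applies to each
  of them, after a shift by \<open>N\<close> because measurability and the bound hold only near
  \<open>p\<close>. The parameter is a quaternion when continuity is proved and a real number for
  second differences.\<close>

lemma integral_dominated_convergence_within:
  fixes s :: "'p::first_countable_topology \<Rightarrow> 'a \<Rightarrow> 'b::{banach, second_countable_topology}"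
  assumes f: "f \<in> borel_measurable M" and s: "eventually (\<lambda>t. s t \<in> borel_measurable M) (at p within S)"
    and w: "integrable M w"
    and lim: "\<And>x. x \<in> space M \<Longrightarrow> ((\<lambda>t. s t x) \<longlongrightarrow> f x) (at p within S)"
    and bound: "eventually (\<lambda>t. \<forall>x\<in>space M. norm (s t x) \<le> w x) (at p within S)"
  shows "((\<lambda>t. integral\<^sup>L M (s t)) \<longlongrightarrow> integral\<^sup>L M f) (at p within S)"
  unfolding tendsto_at_iff_sequentially o_def
proof safe
  fix X assume X: "\<forall>i. X i \<in> S - {p}" "X \<longlonglongrightarrow> p"
  then have X': "filterlim X (at p within S) sequentially"
    by (auto simp: filterlim_at)
  have "eventually (\<lambda>n. s (X n) \<in> borel_measurable M \<and> (\<forall>x\<in>space M. norm (s (X n) x) \<le> w x)) sequentially"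
    using eventually_compose_filterlim[OF s X'] eventually_compose_filterlim[OF bound X']
    by (rule eventually_conj)
  then obtain N where N: "\<And>n. n \<ge> N \<Longrightarrow> s (X n) \<in> borel_measurable M"
    "\<And>n x. n \<ge> N \<Longrightarrow> x \<in> space M \<Longrightarrow> norm (s (X n) x) \<le> w x"
    unfolding eventually_sequentially by blast
  show "(\<lambda>n. integral\<^sup>L M (s (X n))) \<longlonglongrightarrow> integral\<^sup>L M f"
  proof (rule LIMSEQ_offset[of _ N], rule integral_dominated_convergence[where w=w])
    show "AE x in M. (\<lambda>n. s (X (n + N)) x) \<longlonglongrightarrow> f x"
      using filterlim_compose[OF lim X'] by (auto intro!: AE_I2 LIMSEQ_ignore_initial_segment)
  qed (use N f w in auto)
qed

text \<open>The mean value theorem is used twice: for \<open>g \<tau> + g (- \<tau>)\<close> between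
  0 and \<open>\<bar>t\<bar>\<close>, then for \<open>g1\<close> between \<open>- \<tau>\<close> and
  \<open>\<tau>\<close> at the intermediate point \<tau>. The bound dominates the second differences
  of the Poisson kernel.\<close>

lemma second_difference_le:
  fixes g g1 g2 :: "real \<Rightarrow> real"
  assumes g: "\<And>\<tau>. \<bar>\<tau>\<bar> \<le> \<bar>t\<bar> \<Longrightarrow> (g has_real_derivative g1 \<tau>) (at \<tau>)"
    and g1: "\<And>\<tau>. \<bar>\<tau>\<bar> \<le> \<bar>t\<bar> \<Longrightarrow> (g1 has_real_derivative g2 \<tau>) (at \<tau>)"
    and g2: "\<And>\<tau>. \<bar>\<tau>\<bar> \<le> \<bar>t\<bar> \<Longrightarrow> \<bar>g2 \<tau>\<bar> \<le> B"
  shows "\<bar>g t + g (- t) - 2 * g 0\<bar> \<le> 2 * B * t\<^sup>2"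
proof (cases "t = 0")
  case False
  define r where "r = \<bar>t\<bar>"
  have r: "r > 0" using False by (simp add: r_def)
  define \<psi> where "\<psi> = (\<lambda>\<tau>. g \<tau> + g (- \<tau>))"
  have "(\<psi> has_real_derivative g1 \<tau> - g1 (- \<tau>)) (at \<tau>)" if "0 \<le> \<tau>" "\<tau> \<le> r" for \<tau>
  proof -
    have "((\<lambda>t. g (- t)) has_real_derivative g1 (- \<tau>) * - 1) (at \<tau>)"
      using that by (intro DERIV_chain2[of g] g) (auto intro!: derivative_eq_intros simp: r_def)
    then show ?thesis
      unfolding \<psi>_def using g[of \<tau>] that by (auto intro!: derivative_eq_intros simp: r_def)
  qed
  from MVT2[OF r this]
  obtain \<tau> where \<tau>: "0 < \<tau>" "\<tau> < r" "\<psi> r - \<psi> 0 = (r - 0) * (g1 \<tau> - g1 (- \<tau>))"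
    by blast
  have "(g1 has_real_derivative g2 \<sigma>) (at \<sigma>)" if "- \<tau> \<le> \<sigma>" "\<sigma> \<le> \<tau>" for \<sigma>
    using that \<tau> by (intro g1) (auto simp: r_def)
  from MVT2[OF _ this, of "- \<tau>" \<tau>] \<tau>(1)
  obtain \<xi> where \<xi>: "- \<tau> < \<xi>" "\<xi> < \<tau>" "g1 \<tau> - g1 (- \<tau>) = (\<tau> - - \<tau>) * g2 \<xi>"
    by auto
  have "\<bar>g2 \<xi>\<bar> \<le> B"
    using \<xi> \<tau> by (intro g2) (auto simp: r_def)
  then have "\<bar>\<psi> r - \<psi> 0\<bar> \<le> r * (2 * \<tau> * B)"
    using r \<tau> unfolding \<tau>(3) \<xi>(3) by (simp add: abs_mult)
  also have "\<dots> \<le> r * (2 * r * B)"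
    using r \<tau> order_trans[OF abs_ge_zero \<open>\<bar>g2 \<xi>\<bar> \<le> B\<close>]
    by (intro mult_left_mono mult_right_mono) auto
  finally have "\<bar>\<psi> r - \<psi> 0\<bar> \<le> 2 * B * t\<^sup>2"
    using r_def by (simp add: power2_eq_square algebra_simps)
  moreover have "\<psi> r = g t + g (- t)" "\<psi> 0 = 2 * g 0"
    by (auto simp: \<psi>_def r_def abs_if)
  ultimately show ?thesis by simp
qed simp

lemma integrable_sphere_measure:
  fixes g :: "quat \<Rightarrow> 'b::{banach, second_countable_topology}"
  assumes "continuous_on (sphere 0 1) g"
  shows "integrable sphere_measure g"
proof -
  interpret prob_space sphere_measure by (rule prob_space_sphere_measure)
  have "bounded (g ` sphere 0 1)"
    using assms by (intro compact_imp_bounded compact_continuous_image) auto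
  then obtain B where B: "\<And>x. x \<in> sphere 0 1 \<Longrightarrow> norm (g x) \<le> B"
    unfolding bounded_iff by blast
  have "g \<in> borel_measurable (restrict_space borel (sphere 0 1))"
    using assms by (rule borel_measurable_continuous_on_restrict)
  then have "g \<in> borel_measurable sphere_measure"
    by (simp add: measurable_cong_sets[OF sets_sphere_measure refl])
  then show ?thesis
    using B by (intro integrable_const_bound[where B=B] AE_I2) auto
qed

section \<open>Derivatives and harmonicity of the Poisson kernel\<close>

lemma poisson_kernel_eq: "poisson_kernel x \<zeta> = (1 - (norm x)\<^sup>2) / ((norm (x - \<zeta>))\<^sup>2)\<^sup>2"
  by (simp add: poisson_kernel_def)

lemma poisson_kernel_nonneg: "x \<in> ball 0 1 \<Longrightarrow> poisson_kernel x \<zeta> \<ge> 0"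
  by (simp add: poisson_kernel_def power_le_one)

lemma continuous_on_poisson_kernel:
  assumes "x \<in> ball 0 1"
  shows "continuous_on (sphere 0 1) (poisson_kernel x)"
  unfolding poisson_kernel_def using assms by (intro continuous_intros) auto

text \<open>The squared norm is kept as a unit because it is a quadratic polynomial along every
  line: the kernel becomes a rational function, and no root has to be differentiated.\<close>

definition poisson_deriv1 :: "quat \<Rightarrow> quat \<Rightarrow> quat \<Rightarrow> real" where
  "poisson_deriv1 b y \<zeta> = - 2 * (y \<bullet> b) / ((norm (y - \<zeta>))\<^sup>2)\<^sup>2
     - 4 * (1 - (norm y)\<^sup>2) * ((y - \<zeta>) \<bullet> b) / ((norm (y - \<zeta>))\<^sup>2) ^ 3"

definition poisson_deriv2 :: "quat \<Rightarrow> quat \<Rightarrow> quat \<Rightarrow> real" where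
  "poisson_deriv2 b y \<zeta> = - 2 / ((norm (y - \<zeta>))\<^sup>2)\<^sup>2
     + (16 * (y \<bullet> b) * ((y - \<zeta>) \<bullet> b) - 4 * (1 - (norm y)\<^sup>2)) / ((norm (y - \<zeta>))\<^sup>2) ^ 3
     + 24 * (1 - (norm y)\<^sup>2) * ((y - \<zeta>) \<bullet> b)\<^sup>2 / ((norm (y - \<zeta>))\<^sup>2) ^ 4"

lemma poisson_kernel_derivs:
  assumes b: "norm b = 1" and ne: "x + t *\<^sub>R b \<noteq> \<zeta>"
  shows "((\<lambda>t. poisson_kernel (x + t *\<^sub>R b) \<zeta>) has_real_derivative poisson_deriv1 b (x + t *\<^sub>R b) \<zeta>) (at t)"
    and "((\<lambda>t. poisson_deriv1 b (x + t *\<^sub>R b) \<zeta>) has_real_derivative poisson_deriv2 b (x + t *\<^sub>R b) \<zeta>) (at t)"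
proof -
  have sq: "((\<lambda>t. (norm (x + t *\<^sub>R b - c))\<^sup>2) has_real_derivative 2 * ((x + t *\<^sub>R b - c) \<bullet> b)) (at t)" for c
  proof -
    have "(\<lambda>t. (norm (x + t *\<^sub>R b - c))\<^sup>2) = (\<lambda>t. (norm (x - c))\<^sup>2 + 2 * t * ((x - c) \<bullet> b) + t\<^sup>2)"
      using b unfolding power2_norm_eq_inner norm_eq_1
      by (intro ext) (simp add: inner_simps inner_commute algebra_simps power2_eq_square)
    then show ?thesis
      using b by (auto intro!: derivative_eq_intros simp: inner_simps norm_eq_1 algebra_simps)
  qed
  have lin: "((\<lambda>t. (x + t *\<^sub>R b - c) \<bullet> b) has_real_derivative 1) (at t)" for c
  proof -
    have "(\<lambda>t. (x + t *\<^sub>R b - c) \<bullet> b) = (\<lambda>t. (x - c) \<bullet> b + t)"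
      using b by (intro ext) (simp add: inner_simps norm_eq_1)
    then show ?thesis by (auto intro!: derivative_eq_intros)
  qed
  \<comment> \<open>These four functions are closed under differentiation, with derivatives 1, 1,
    \<open>- 2 * p t\<close> and \<open>2 * d t\<close>; the kernel is
    \<open>n t / (D t)\<^sup>2\<close>.\<close>
  define p where "p = (\<lambda>t. (x + t *\<^sub>R b) \<bullet> b)"
  define d where "d = (\<lambda>t. (x + t *\<^sub>R b - \<zeta>) \<bullet> b)"
  define n where "n = (\<lambda>t. 1 - (norm (x + t *\<^sub>R b))\<^sup>2)"
  define D where "D = (\<lambda>t. (norm (x + t *\<^sub>R b - \<zeta>))\<^sup>2)"
  have 1: "(p has_real_derivative 1) (at t)" "(d has_real_derivative 1) (at t)"
    "(n has_real_derivative - 2 * p t) (at t)" "(D has_real_derivative 2 * d t) (at t)"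
    using lin[of 0] lin[of \<zeta>] sq[of \<zeta>] DERIV_diff[OF DERIV_const[of 1] sq[of 0]]
    unfolding p_def d_def n_def D_def by (simp_all add: algebra_simps)
  have 2: "D t \<noteq> 0" using ne by (simp add: D_def)
  have "((\<lambda>t. n t / (D t)\<^sup>2) has_real_derivative - 2 * p t / (D t)\<^sup>2 - 4 * n t * d t / (D t) ^ 3) (at t)"
    using 2 by (auto intro!: derivative_eq_intros 1 simp: divide_simps) algebra
  then show "((\<lambda>t. poisson_kernel (x + t *\<^sub>R b) \<zeta>) has_real_derivative poisson_deriv1 b (x + t *\<^sub>R b) \<zeta>) (at t)"
    unfolding poisson_kernel_eq poisson_deriv1_def n_def D_def p_def d_def .
  have "((\<lambda>t. - 2 * p t / (D t)\<^sup>2 - 4 * n t * d t / (D t) ^ 3) has_real_derivative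
     - 2 / (D t)\<^sup>2 + (16 * p t * d t - 4 * n t) / (D t) ^ 3 + 24 * n t * (d t)\<^sup>2 / (D t) ^ 4) (at t)"
    using 2 by (auto intro!: derivative_eq_intros 1) (simp add: divide_simps, algebra)
  then show "((\<lambda>t. poisson_deriv1 b (x + t *\<^sub>R b) \<zeta>) has_real_derivative poisson_deriv2 b (x + t *\<^sub>R b) \<zeta>) (at t)"
    unfolding poisson_deriv1_def poisson_deriv2_def n_def D_def p_def d_def .
qed

lemma DIM_quat: "DIM(quat) = 4"
  by (simp add: Basis_quat_eq quat_i_def quat_j_def quat_k_def quat_eq_iff)

text \<open>Over the common denominator \<open>D ^ 3\<close> the numerator is affine in
  \<open>D\<close>, \<open>(norm y)\<^sup>2\<close> and \<open>y \<bullet> \<zeta>\<close>, and it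
  vanishes once \<open>D\<close> is expanded for a unit vector \<zeta>. The dimension enters through
  the number of summands and matches the exponent 4 of the kernel.\<close>

lemma sum_poisson_deriv2:
  assumes "norm \<zeta> = 1" "y \<noteq> \<zeta>"
  shows "(\<Sum>b\<in>Basis. poisson_deriv2 b y \<zeta>) = 0"
proof -
  define D where "D = (norm (y - \<zeta>))\<^sup>2"
  have D: "D \<noteq> 0" using assms by (simp add: D_def)
  have D': "D = (norm y)\<^sup>2 - 2 * (y \<bullet> \<zeta>) + 1"
    using assms(1) unfolding D_def power2_norm_eq_inner norm_eq_1
    by (simp add: inner_simps inner_commute)
  have "(\<Sum>b\<in>Basis. poisson_deriv2 b y \<zeta>) = - 8 / D\<^sup>2
     + (16 * (\<Sum>b\<in>Basis. (y \<bullet> b) * ((y - \<zeta>) \<bullet> b)) - 16 * (1 - (norm y)\<^sup>2)) / D ^ 3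
     + 24 * (1 - (norm y)\<^sup>2) * (\<Sum>b\<in>Basis. ((y - \<zeta>) \<bullet> b) * ((y - \<zeta>) \<bullet> b)) / D ^ 4"
    unfolding poisson_deriv2_def D_def[symmetric]
    by (simp add: sum.distrib sum_subtractf sum_divide_distrib[symmetric] sum_distrib_left[symmetric]
        DIM_quat mult.assoc power2_eq_square)
  also have "\<dots> = - 8 / D\<^sup>2 + (16 * (y \<bullet> (y - \<zeta>)) - 16 * (1 - (norm y)\<^sup>2)) / D ^ 3
     + 24 * (1 - (norm y)\<^sup>2) * D / D ^ 4"
    unfolding euclidean_inner[symmetric] by (simp add: D_def power2_norm_eq_inner)
  also have "y \<bullet> (y - \<zeta>) = (norm y)\<^sup>2 - y \<bullet> \<zeta>"
    by (simp add: inner_simps power2_norm_eq_inner)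
  also have "- 8 / D\<^sup>2 + (16 * ((norm y)\<^sup>2 - y \<bullet> \<zeta>) - 16 * (1 - (norm y)\<^sup>2)) / D ^ 3
     + 24 * (1 - (norm y)\<^sup>2) * D / D ^ 4 =
     (- 8 * D + 16 * ((norm y)\<^sup>2 - y \<bullet> \<zeta>) + 8 * (1 - (norm y)\<^sup>2)) / D ^ 3"
    using D by (simp add: divide_simps) algebra
  also have "\<dots> = 0" by (simp add: D')
  finally show ?thesis .
qed

lemma continuous_on_poisson_kernel_pair:
  assumes "R < 1"
  shows "continuous_on (cball 0 R \<times> sphere 0 1) (\<lambda>z. poisson_kernel (fst z) (snd z))"
    and "continuous_on (cball 0 R \<times> sphere 0 1) (\<lambda>z. poisson_deriv2 b (fst z) (snd z))"
  unfolding poisson_kernel_def poisson_deriv2_def using assms by (auto intro!: continuous_intros)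

text \<open>The denominators do not vanish on the compact set
  \<open>cball 0 R \<times> sphere 0 1\<close>; summing over \<open>Basis\<close> makes the bound
  uniform in the direction.\<close>

lemma poisson_kernel_bounds:
  assumes "R < 1"
  obtains B where "\<And>y \<zeta>. y \<in> cball 0 R \<Longrightarrow> \<zeta> \<in> sphere 0 1 \<Longrightarrow> \<bar>poisson_kernel y \<zeta>\<bar> \<le> B"
    "\<And>b y \<zeta>. b \<in> Basis \<Longrightarrow> y \<in> cball 0 R \<Longrightarrow> \<zeta> \<in> sphere 0 1 \<Longrightarrow> \<bar>poisson_deriv2 b y \<zeta>\<bar> \<le> B"
proof -
  have "\<exists>B. \<forall>y\<in>cball 0 R. \<forall>\<zeta>\<in>sphere 0 1. \<bar>g y \<zeta>\<bar> \<le> B"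
    if "continuous_on (cball 0 R \<times> sphere 0 1) (\<lambda>z. g (fst z) (snd z))" for g :: "quat \<Rightarrow> quat \<Rightarrow> real"
  proof -
    have "bounded ((\<lambda>z. g (fst z) (snd z)) ` (cball 0 R \<times> sphere 0 1))"
      using that by (intro compact_imp_bounded compact_continuous_image) (auto intro: compact_Times)
    then show ?thesis
      unfolding bounded_iff by force
  qed
  note * = this[OF continuous_on_poisson_kernel_pair(1)[OF assms]] this[OF continuous_on_poisson_kernel_pair(2)[OF assms]]
  obtain B0 where B0: "\<And>y \<zeta>. y \<in> cball 0 R \<Longrightarrow> \<zeta> \<in> sphere 0 1 \<Longrightarrow> \<bar>poisson_kernel y \<zeta>\<bar> \<le> B0"
    using *(1) by blast
  obtain B1 where B1: "\<And>b y \<zeta>. y \<in> cball 0 R \<Longrightarrow> \<zeta> \<in> sphere 0 1 \<Longrightarrow> \<bar>poisson_deriv2 b y \<zeta>\<bar> \<le> B1 b"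
    using *(2) by metis
  have "B1 b \<le> (\<Sum>b\<in>Basis. \<bar>B1 b\<bar>)" if "b \<in> Basis" for b
    using member_le_sum[OF that, of "\<lambda>b. \<bar>B1 b\<bar>"] by simp
  then have "\<bar>poisson_deriv2 b y \<zeta>\<bar> \<le> max B0 (\<Sum>b\<in>Basis. \<bar>B1 b\<bar>)"
    if "b \<in> Basis" "y \<in> cball 0 R" "\<zeta> \<in> sphere 0 1" for b y \<zeta>
    using that B1[of y \<zeta> b] by (meson order_trans max.cobounded2)
  moreover have "\<bar>poisson_kernel y \<zeta>\<bar> \<le> max B0 (\<Sum>b\<in>Basis. \<bar>B1 b\<bar>)"
    if "y \<in> cball 0 R" "\<zeta> \<in> sphere 0 1" for y \<zeta>
    using that B0[of y \<zeta>] by simp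
  ultimately show ?thesis using that by blast
qed

section \<open>Poisson integrals of continuous boundary data\<close>

definition poisson_integral :: "(quat \<Rightarrow> real) \<Rightarrow> quat \<Rightarrow> real" where
  "poisson_integral \<phi> x = (\<integral>\<zeta>. poisson_kernel x \<zeta> * \<phi> \<zeta> \<partial>sphere_measure)"

lemma integrable_poisson:
  assumes "x \<in> ball 0 1" "continuous_on (sphere 0 1) \<phi>"
  shows "integrable sphere_measure (\<lambda>\<zeta>. poisson_kernel x \<zeta> * \<phi> \<zeta> :: real)"
  by (intro integrable_sphere_measure continuous_on_mult continuous_on_poisson_kernel assms)

lemma isCont_poisson_integral:
  assumes x: "x \<in> ball 0 1" and \<phi>: "continuous_on (sphere 0 1) \<phi>"
  shows "isCont (poisson_integral \<phi>) x"
proof -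
  define R where "R = (1 + norm x) / 2"
  have R: "R < 1" "norm x < R" using x by (auto simp: R_def)
  obtain B where B: "\<And>y \<zeta>. y \<in> cball 0 R \<Longrightarrow> \<zeta> \<in> sphere 0 1 \<Longrightarrow> \<bar>poisson_kernel y \<zeta>\<bar> \<le> B"
    using poisson_kernel_bounds[OF R(1)] by metis
  have ev: "eventually (\<lambda>y. y \<in> ball 0 R) (at x)"
    using R by (intro eventually_at_in_open') auto
  show ?thesis
    unfolding isCont_def poisson_integral_def
  proof (rule integral_dominated_convergence_within)
    show "(\<lambda>\<zeta>. poisson_kernel x \<zeta> * \<phi> \<zeta>) \<in> borel_measurable sphere_measure"
      using integrable_poisson[OF x \<phi>] by simp
    show "eventually (\<lambda>y. (\<lambda>\<zeta>. poisson_kernel y \<zeta> * \<phi> \<zeta>) \<in> borel_measurable sphere_measure) (at x)"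
      using ev by eventually_elim (use integrable_poisson[OF _ \<phi>] R in auto)
    show "integrable sphere_measure (\<lambda>\<zeta>. B * \<bar>\<phi> \<zeta>\<bar>)"
      by (intro integrable_sphere_measure continuous_intros \<phi>)
    show "((\<lambda>y. poisson_kernel y \<zeta> * \<phi> \<zeta>) \<longlongrightarrow> poisson_kernel x \<zeta> * \<phi> \<zeta>) (at x)"
      if "\<zeta> \<in> space sphere_measure" for \<zeta>
      unfolding poisson_kernel_def using x that by (intro tendsto_intros) auto
    show "eventually (\<lambda>y. \<forall>\<zeta>\<in>space sphere_measure. norm (poisson_kernel y \<zeta> * \<phi> \<zeta>) \<le> B * \<bar>\<phi> \<zeta>\<bar>) (at x)"
      using ev by eventually_elim (use B in \<open>auto simp: abs_mult intro!: mult_right_mono\<close>)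
  qed
qed

text \<open>Dominated convergence moves the limit inside the integral: the second difference
  quotients \<open>Q\<close> of the kernel tend to 0 pointwise by harmonicity and are bounded
  uniformly in \<zeta>.\<close>

lemma has_laplacian_poisson_integral:
  assumes x: "x \<in> ball 0 1" and \<phi>: "continuous_on (sphere 0 1) \<phi>"
  shows "has_laplacian (poisson_integral \<phi>) x 0"
proof -
  define s where "s = (1 - norm x) / 2"
  define R where "R = norm x + s"
  have R: "R < 1" and s: "s > 0" using x by (auto simp: R_def s_def field_simps)
  have xR: "x + \<tau> *\<^sub>R b \<in> cball 0 R" if "b \<in> Basis" "\<bar>\<tau>\<bar> \<le> s" for \<tau> and b :: quat
    using that norm_triangle_ineq[of x "\<tau> *\<^sub>R b"] by (simp add: R_def)
  have xb: "x + \<tau> *\<^sub>R b \<in> ball 0 1" "x - \<tau> *\<^sub>R b \<in> ball 0 1" if "b \<in> Basis" "\<bar>\<tau>\<bar> \<le> s" for \<tau> and b :: quat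
    using xR[OF that] xR[of b "-\<tau>"] that R by auto
  obtain B where B: "\<And>b y \<zeta>. b \<in> Basis \<Longrightarrow> y \<in> cball 0 R \<Longrightarrow> \<zeta> \<in> sphere 0 1 \<Longrightarrow> \<bar>poisson_deriv2 b y \<zeta>\<bar> \<le> B"
    using poisson_kernel_bounds[OF R] by metis
  define Q where "Q = (\<lambda>t \<zeta>. (\<Sum>b\<in>Basis. poisson_kernel (x + t *\<^sub>R b) \<zeta> + poisson_kernel (x - t *\<^sub>R b) \<zeta>
     - 2 * poisson_kernel x \<zeta>) / t\<^sup>2)"
  have der: "((\<lambda>t. poisson_kernel (x + t *\<^sub>R b) \<zeta>) has_real_derivative poisson_deriv1 b (x + \<tau> *\<^sub>R b) \<zeta>) (at \<tau>)"
    "((\<lambda>t. poisson_deriv1 b (x + t *\<^sub>R b) \<zeta>) has_real_derivative poisson_deriv2 b (x + \<tau> *\<^sub>R b) \<zeta>) (at \<tau>)"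
    if "b \<in> Basis" "\<bar>\<tau>\<bar> \<le> s" "\<zeta> \<in> sphere 0 1" for b \<tau> \<zeta>
    using that xb[of b \<tau>] by (auto intro!: poisson_kernel_derivs)
  have ev: "eventually (\<lambda>t. t \<noteq> 0 \<and> \<bar>t\<bar> \<le> s) (at (0::real))"
    using s unfolding eventually_at by (intro exI[of _ s]) auto
  have Qlim: "((\<lambda>t. Q t \<zeta>) \<longlongrightarrow> 0) (at 0)" if \<zeta>: "\<zeta> \<in> sphere 0 1" for \<zeta>
  proof -
    have "has_laplacian (\<lambda>y. poisson_kernel y \<zeta>) x (\<Sum>b\<in>Basis. poisson_deriv2 b x \<zeta>)"
    proof (rule has_laplacianI)
      fix b :: quat assume b: "b \<in> Basis"
      have "eventually (\<lambda>t. \<bar>t\<bar> < s) (nhds 0)"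
        using s eventually_nhds_in_open[of "{- s<..<s}" 0] by (auto elim!: eventually_mono)
      then show "eventually (\<lambda>t. ((\<lambda>t. poisson_kernel (x + t *\<^sub>R b) \<zeta>) has_real_derivative
          poisson_deriv1 b (x + t *\<^sub>R b) \<zeta>) (at t)) (nhds 0)"
        by eventually_elim (use b \<zeta> in \<open>auto intro!: der\<close>)
      show "((\<lambda>t. poisson_deriv1 b (x + t *\<^sub>R b) \<zeta>) has_real_derivative poisson_deriv2 b x \<zeta>) (at 0)"
        using der(2)[OF b _ \<zeta>, of 0] s by simp
    qed
    moreover have "(\<Sum>b\<in>Basis. poisson_deriv2 b x \<zeta>) = 0"
      using \<zeta> x by (intro sum_poisson_deriv2) auto
    ultimately show ?thesis
      by (simp add: has_laplacian_def Q_def)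
  qed
  \<comment> \<open>Each of the four basis directions contributes \<open>2 * B\<close>.\<close>
  have Qbd: "\<bar>Q t \<zeta>\<bar> \<le> 8 * B" if t: "t \<noteq> 0" "\<bar>t\<bar> \<le> s" and \<zeta>: "\<zeta> \<in> sphere 0 1" for t \<zeta>
  proof -
    have "\<bar>poisson_kernel (x + t *\<^sub>R b) \<zeta> + poisson_kernel (x - t *\<^sub>R b) \<zeta> - 2 * poisson_kernel x \<zeta>\<bar> \<le> 2 * B * t\<^sup>2"
      if b: "b \<in> Basis" for b
      using second_difference_le[of t "\<lambda>t. poisson_kernel (x + t *\<^sub>R b) \<zeta>"
          "\<lambda>t. poisson_deriv1 b (x + t *\<^sub>R b) \<zeta>" "\<lambda>t. poisson_deriv2 b (x + t *\<^sub>R b) \<zeta>" B]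
        der[OF b _ \<zeta>] B[OF b xR[OF b] \<zeta>] t by auto
    then have "\<bar>\<Sum>b\<in>Basis. poisson_kernel (x + t *\<^sub>R b) \<zeta> + poisson_kernel (x - t *\<^sub>R b) \<zeta>
        - 2 * poisson_kernel x \<zeta>\<bar> \<le> (\<Sum>b\<in>(Basis::quat set). 2 * B * t\<^sup>2)"
      by (intro order_trans[OF sum_abs] sum_mono)
    then show ?thesis
      using t by (simp add: Q_def DIM_quat divide_le_eq abs_divide)
  qed
  have int: "integrable sphere_measure (\<lambda>\<zeta>. poisson_kernel (x + t *\<^sub>R b) \<zeta> * \<phi> \<zeta>)"
    "integrable sphere_measure (\<lambda>\<zeta>. poisson_kernel (x - t *\<^sub>R b) \<zeta> * \<phi> \<zeta>)"
    if "b \<in> Basis" "\<bar>t\<bar> \<le> s" for b t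
    using xb[OF that] by (auto intro!: integrable_poisson \<phi>)
  have Qint: "integrable sphere_measure (\<lambda>\<zeta>. Q t \<zeta> * \<phi> \<zeta>)"
    "(\<integral>\<zeta>. Q t \<zeta> * \<phi> \<zeta> \<partial>sphere_measure) = (\<Sum>b\<in>Basis. poisson_integral \<phi> (x + t *\<^sub>R b)
      + poisson_integral \<phi> (x - t *\<^sub>R b) - 2 * poisson_integral \<phi> x) / t\<^sup>2" if "\<bar>t\<bar> \<le> s" for t
  proof -
    have eq: "(\<lambda>\<zeta>. Q t \<zeta> * \<phi> \<zeta>) = (\<lambda>\<zeta>. (\<Sum>b\<in>Basis. poisson_kernel (x + t *\<^sub>R b) \<zeta> * \<phi> \<zeta>
      + poisson_kernel (x - t *\<^sub>R b) \<zeta> * \<phi> \<zeta> - 2 * (poisson_kernel x \<zeta> * \<phi> \<zeta>)) / t\<^sup>2)"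
      unfolding Q_def times_divide_eq_left sum_distrib_right
      by (simp add: left_diff_distrib distrib_right mult.assoc)
    show "integrable sphere_measure (\<lambda>\<zeta>. Q t \<zeta> * \<phi> \<zeta>)"
      unfolding eq using int[OF _ that] integrable_poisson[OF x \<phi>] by auto
    show "(\<integral>\<zeta>. Q t \<zeta> * \<phi> \<zeta> \<partial>sphere_measure) = (\<Sum>b\<in>Basis. poisson_integral \<phi> (x + t *\<^sub>R b)
      + poisson_integral \<phi> (x - t *\<^sub>R b) - 2 * poisson_integral \<phi> x) / t\<^sup>2"
      unfolding eq poisson_integral_def
      using int[OF _ that] integrable_poisson[OF x \<phi>] by simp
  qed
  have "((\<lambda>t. \<integral>\<zeta>. Q t \<zeta> * \<phi> \<zeta> \<partial>sphere_measure) \<longlongrightarrow> (\<integral>\<zeta>. 0 \<partial>sphere_measure)) (at 0)"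
  proof (rule integral_dominated_convergence_within)
    show "eventually (\<lambda>t. (\<lambda>\<zeta>. Q t \<zeta> * \<phi> \<zeta>) \<in> borel_measurable sphere_measure) (at 0)"
      using ev by eventually_elim (use Qint in auto)
    show "integrable sphere_measure (\<lambda>\<zeta>. 8 * B * \<bar>\<phi> \<zeta>\<bar>)"
      by (intro integrable_sphere_measure continuous_intros \<phi>)
    show "((\<lambda>t. Q t \<zeta> * \<phi> \<zeta>) \<longlongrightarrow> 0) (at 0)" if "\<zeta> \<in> space sphere_measure" for \<zeta>
      using tendsto_mult_right[OF Qlim, of \<zeta> "\<phi> \<zeta>"] that by simp
    show "eventually (\<lambda>t. \<forall>\<zeta>\<in>space sphere_measure. norm (Q t \<zeta> * \<phi> \<zeta>) \<le> 8 * B * \<bar>\<phi> \<zeta>\<bar>) (at 0)"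
      using ev by eventually_elim (use Qbd in \<open>auto simp: abs_mult intro!: mult_right_mono\<close>)
  qed simp
  then have "((\<lambda>t. \<integral>\<zeta>. Q t \<zeta> * \<phi> \<zeta> \<partial>sphere_measure) \<longlongrightarrow> 0) (at 0)"
    by simp
  then show ?thesis
    unfolding has_laplacian_def
    by (rule Lim_transform_eventually) (use ev Qint(2) in \<open>auto elim: eventually_mono\<close>)
qed

text \<open>The integral is a harmonic function of \<open>x\<close> that is constant on spheres around 0, so by the
  comparison principle it equals its value at 0.\<close>

lemma integral_poisson_kernel:
  assumes x: "x \<in> ball 0 1"
  shows "(\<integral>\<zeta>. poisson_kernel x \<zeta> \<partial>sphere_measure) = 1"
proof -
  interpret prob_space sphere_measure by (rule prob_space_sphere_measure)
  define m where "m = poisson_integral (\<lambda>\<zeta>. 1)"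
  have m0: "m 0 = 1"
  proof -
    have "m 0 = (\<integral>\<zeta>. 1 \<partial>sphere_measure)"
      unfolding m_def poisson_integral_def
      by (intro Bochner_Integration.integral_cong) (auto simp: poisson_kernel_def)
    then show ?thesis by (simp add: prob_space del: space_sphere_measure)
  qed
  have rot: "m y = m x" if "norm y = norm x" "x \<noteq> 0" for y
  proof -
    \<comment> \<open>Left multiplication by this unit quaternion carries \<open>x\<close> to
      \<open>y\<close>. The kernel does not change when both arguments are rotated, and neither does
      the measure.\<close>
    define u where "u = y * inverse x"
    have u: "norm u = 1" "u * x = y" "inverse u * u = 1"
      using that by (auto simp: u_def norm_mult norm_inverse mult.assoc intro!: left_inverse)
    have T: "orthogonal_transformation ((*) u)"
      using u by (auto simp: orthogonal_transformation norm_mult algebra_simps intro!: linearI)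
    have "m y = (\<integral>\<zeta>. poisson_kernel y \<zeta> \<partial>distr sphere_measure sphere_measure ((*) u))"
      by (simp add: sphere_measure_rotation_invariant[OF T] m_def poisson_integral_def)
    also have "\<dots> = (\<integral>\<zeta>. poisson_kernel y (u * \<zeta>) \<partial>sphere_measure)"
    proof (rule integral_distr[OF orthogonal_measurable_sphere[OF T]])
      have "y \<in> ball 0 1" using that x by auto
      from integrable_poisson[OF this continuous_on_const[of _ 1]]
      show "poisson_kernel y \<in> borel_measurable sphere_measure" by auto
    qed
    also have "\<dots> = (\<integral>\<zeta>. poisson_kernel x \<zeta> \<partial>sphere_measure)"
    proof -
      have "norm (u * x - u * \<zeta>) = norm (x - \<zeta>)" for \<zeta>
        by (simp only: right_diff_distrib[symmetric] norm_mult u(1) mult_1)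
      then show ?thesis
        using that by (simp add: poisson_kernel_def u(2)[symmetric])
    qed
    finally show ?thesis by (simp add: m_def poisson_integral_def)
  qed
  have "m x = 1"
  proof (cases "x = 0")
    case False
    have cont: "continuous_on (cball 0 (norm x)) m"
      using x unfolding m_def
      by (intro continuous_at_imp_continuous_on ballI isCont_poisson_integral) auto
    have lap: "has_laplacian m y 0" if "y \<in> ball 0 (norm x)" for y
      using that x unfolding m_def by (intro has_laplacian_poisson_integral) auto
    have "m 0 = m x"
    proof (rule comparison_principle[OF cont continuous_on_const, where c = 0])
      show "m y = m x" if "y \<in> sphere 0 (norm x)" for y
        by (rule rot) (use that False in auto)
    qed (use False lap has_laplacian_const in auto)
    then show ?thesis using m0 by simp
  qed (simp add: m0)
  then show ?thesis by (simp add: m_def poisson_integral_def)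
qed

text \<open>The kernel is an approximate identity: it is nonnegative with total mass 1, so the part
  near \<open>\<zeta>0\<close> is controlled by the continuity of \<phi>, while away from
  \<open>\<zeta>0\<close> the kernel tends uniformly to 0.\<close>

lemma poisson_integral_boundary:
  assumes \<phi>: "continuous_on (sphere 0 1) \<phi>" and \<zeta>0: "\<zeta>0 \<in> sphere 0 1"
  shows "(poisson_integral \<phi> \<longlongrightarrow> \<phi> \<zeta>0) (at \<zeta>0 within ball 0 1)"
proof (rule tendstoI)
  interpret prob_space sphere_measure by (rule prob_space_sphere_measure)
  fix e :: real assume e: "e > 0"
  have "bounded (\<phi> ` sphere 0 1)"
    using \<phi> by (intro compact_imp_bounded compact_continuous_image) auto
  then obtain M where M: "\<And>\<zeta>. \<zeta> \<in> sphere 0 1 \<Longrightarrow> \<bar>\<phi> \<zeta>\<bar> \<le> M"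
    unfolding bounded_iff real_norm_def by blast
  obtain \<delta> where \<delta>: "\<delta> > 0" "\<And>\<zeta>. \<zeta> \<in> sphere 0 1 \<Longrightarrow> dist \<zeta> \<zeta>0 < \<delta> \<Longrightarrow> \<bar>\<phi> \<zeta> - \<phi> \<zeta>0\<bar> < e / 2"
    using \<phi> \<zeta>0 e unfolding continuous_on_iff dist_real_def by (metis half_gt_zero)
  \<comment> \<open>Here \<open>2 * M\<close> bounds the oscillation of \<phi>, and
    \<open>\<delta> / 2\<close> is the distance that remains between \<open>x\<close> and \<zeta>
    when \<zeta> is at least \<delta> and \<open>x\<close> less than \<open>\<delta> / 2\<close>
    away from \<open>\<zeta>0\<close>.\<close>
  define C where "C = 2 * M / (\<delta> / 2) ^ 4"
  have "((\<lambda>x. C * (1 - (norm x)\<^sup>2)) \<longlongrightarrow> C * (1 - (norm \<zeta>0)\<^sup>2)) (at \<zeta>0 within ball 0 1)"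
    by (intro tendsto_intros)
  then have "((\<lambda>x. C * (1 - (norm x)\<^sup>2)) \<longlongrightarrow> 0) (at \<zeta>0 within ball 0 1)"
    using \<zeta>0 by simp
  then have "eventually (\<lambda>x. C * (1 - (norm x)\<^sup>2) < e / 2) (at \<zeta>0 within ball 0 1)"
    using e by (intro order_tendstoD) auto
  moreover have "eventually (\<lambda>x. x \<in> ball 0 1) (at \<zeta>0 within ball 0 1)"
    by (simp add: eventually_at_filter)
  moreover have "eventually (\<lambda>x. dist x \<zeta>0 < \<delta> / 2) (at \<zeta>0 within ball 0 1)"
    using \<delta>(1) unfolding eventually_at by (intro exI[of _ "\<delta> / 2"]) auto
  ultimately show "eventually (\<lambda>x. dist (poisson_integral \<phi> x) (\<phi> \<zeta>0) < e) (at \<zeta>0 within ball 0 1)"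
  proof eventually_elim
    case (elim x)
    have P: "integrable sphere_measure (poisson_kernel x)"
      using integrable_poisson[OF elim(2) continuous_on_const[of _ 1]] by simp
    note int = integrable_poisson[OF elim(2) \<phi>] P
    have le: "\<bar>poisson_kernel x \<zeta> * \<phi> \<zeta> - \<phi> \<zeta>0 * poisson_kernel x \<zeta>\<bar> \<le> (e / 2) * poisson_kernel x \<zeta> + C * (1 - (norm x)\<^sup>2)"
      if \<zeta>: "\<zeta> \<in> sphere 0 1" for \<zeta>
    proof -
      note nn = poisson_kernel_nonneg[OF elim(2), of \<zeta>]
      have M0: "M \<ge> 0" using M[OF \<zeta>0] by simp
      have x1: "1 - (norm x)\<^sup>2 \<ge> 0" using elim(2) by (simp add: power_le_one)
      have C0: "C * (1 - (norm x)\<^sup>2) \<ge> 0"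
        using M0 x1 by (simp add: C_def)
      have eq: "\<bar>poisson_kernel x \<zeta> * \<phi> \<zeta> - \<phi> \<zeta>0 * poisson_kernel x \<zeta>\<bar> = \<bar>\<phi> \<zeta> - \<phi> \<zeta>0\<bar> * poisson_kernel x \<zeta>"
        using nn by (simp add: abs_mult left_diff_distrib[symmetric] mult.commute[of "poisson_kernel x \<zeta>"])
      show ?thesis
      proof (cases "dist \<zeta> \<zeta>0 < \<delta>")
        case True
        then have "\<bar>\<phi> \<zeta> - \<phi> \<zeta>0\<bar> * poisson_kernel x \<zeta> \<le> (e / 2) * poisson_kernel x \<zeta>"
          using \<delta>(2)[OF \<zeta>] nn by (intro mult_right_mono) auto
        then show ?thesis unfolding eq using C0 by linarith
      next
        case False
        then have "norm (x - \<zeta>) \<ge> \<delta> / 2"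
          using elim(3) dist_triangle[of \<zeta> \<zeta>0 x] by (simp add: dist_norm norm_minus_commute)
        then have "poisson_kernel x \<zeta> \<le> (1 - (norm x)\<^sup>2) / (\<delta> / 2) ^ 4"
          using \<delta>(1) x1 unfolding poisson_kernel_def
          by (intro divide_left_mono power_mono mult_pos_pos zero_less_power) auto
        moreover have "\<bar>\<phi> \<zeta> - \<phi> \<zeta>0\<bar> \<le> 2 * M"
          using M[OF \<zeta>] M[OF \<zeta>0] by linarith
        ultimately have "\<bar>\<phi> \<zeta> - \<phi> \<zeta>0\<bar> * poisson_kernel x \<zeta> \<le> 2 * M * ((1 - (norm x)\<^sup>2) / (\<delta> / 2) ^ 4)"
          using nn M0 by (intro mult_mono) auto
        also have "\<dots> = C * (1 - (norm x)\<^sup>2)" by (simp add: C_def)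
        finally show ?thesis unfolding eq using nn e by (simp add: add_increasing)
      qed
    qed
    have "poisson_integral \<phi> x - \<phi> \<zeta>0 = (\<integral>\<zeta>. poisson_kernel x \<zeta> * \<phi> \<zeta> - \<phi> \<zeta>0 * poisson_kernel x \<zeta> \<partial>sphere_measure)"
      using int integral_poisson_kernel[OF elim(2)] by (simp add: poisson_integral_def)
    also have "\<bar>\<dots>\<bar> \<le> (\<integral>\<zeta>. (e / 2) * poisson_kernel x \<zeta> + C * (1 - (norm x)\<^sup>2) \<partial>sphere_measure)"
      using int le by (intro integral_abs_bound[THEN order_trans] integral_mono) auto
    also have "\<dots> = e / 2 + C * (1 - (norm x)\<^sup>2)"
      using int integral_poisson_kernel[OF elim(2)] by (simp add: prob_space del: space_sphere_measure)
    finally show ?case using elim(1) by (simp add: dist_real_def)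
  qed
qed

text \<open>The Poisson integral of the boundary values of \<open>u\<close>, completed by
  \<open>u\<close> on the sphere, is continuous on the closed ball and harmonic in all of the open
  ball. The comparison principle identifies it with \<open>u\<close>, whose harmonicity is known
  only off a line.\<close>

lemma poisson_representation:
  fixes u :: "quat \<Rightarrow> real"
  assumes cont: "continuous_on (cball 0 1) u" and c: "qRe c = 0"
    and lap: "\<And>y. y \<in> ball 0 1 \<Longrightarrow> qim y \<noteq> c \<Longrightarrow> has_laplacian u y 0"
    and x: "x \<in> ball 0 1"
  shows "u x = (\<integral>\<zeta>. poisson_kernel x \<zeta> * u \<zeta> \<partial>sphere_measure)"
proof -
  have u: "continuous_on (sphere 0 1) u"
    using cont by (rule continuous_on_subset) auto
  define U where "U = (\<lambda>y. if y \<in> ball 0 1 then poisson_integral u y else u y)"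
  have U_ev: "eventually (\<lambda>z. poisson_integral u z = U z) (nhds y)" if "y \<in> ball 0 1" for y
    using eventually_nhds_in_open[OF open_ball that] by eventually_elim (simp add: U_def)
  have "continuous_on (cball 0 1) U"
    unfolding continuous_on_def
  proof
    fix y :: quat assume y: "y \<in> cball 0 1"
    show "(U \<longlongrightarrow> U y) (at y within cball 0 1)"
    proof (cases "y \<in> ball 0 1")
      case True
      have "isCont U y"
        using isCont_poisson_integral[OF True u] isCont_cong[OF U_ev[OF True]] by blast
      then show ?thesis
        by (auto simp: isCont_def intro: tendsto_within_subset[of _ _ _ UNIV])
    next
      case False
      then have yS: "y \<in> sphere 0 1" using y by auto
      have "(U \<longlongrightarrow> u y) (at y within ball 0 1)"
      proof (rule Lim_transform_eventually[OF poisson_integral_boundary[OF u yS]])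
        show "eventually (\<lambda>x. poisson_integral u x = U x) (at y within ball 0 1)"
          by (simp add: U_def eventually_at_filter)
      qed
      moreover have "(U \<longlongrightarrow> u y) (at y within sphere 0 1)"
      proof (rule Lim_transform_eventually)
        show "(u \<longlongrightarrow> u y) (at y within sphere 0 1)"
          using u yS by (simp add: continuous_on_def)
        show "eventually (\<lambda>x. u x = U x) (at y within sphere 0 1)"
          by (auto simp: U_def eventually_at_filter)
      qed
      \<comment> \<open>A boundary point is approached separately from inside and along the sphere;
        together the two cover the closed ball.\<close>
      ultimately have "(U \<longlongrightarrow> u y) (at y within (ball 0 1 \<union> sphere 0 1))"
        by (simp add: Lim_within_Un)
      moreover have "ball 0 1 \<union> sphere 0 1 = (cball 0 1 :: quat set)" by auto
      moreover have "U y = u y" using False by (simp add: U_def)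
      ultimately show ?thesis by simp
    qed
  qed
  note cont' = cont this
  have lapU: "has_laplacian U y 0" if "y \<in> ball 0 1" for y
    using has_laplacian_cong[OF has_laplacian_poisson_integral[OF that u] U_ev[OF that]] .
  have "u x = U x"
  proof (rule comparison_principle[OF cont' _ lap _ c x])
    show "u y = U y" if "y \<in> sphere 0 1" for y
      using that by (simp add: U_def)
  qed (use lapU in auto)
  then show ?thesis using x by (simp add: U_def poisson_integral_def)
qed

section \<open>Spheres and slices\<close>

lemma norm_sq_qRe_qim: "(norm x)\<^sup>2 = (qRe x)\<^sup>2 + (norm (qim x))\<^sup>2"
  by (simp add: norm_quat_sq)

lemma quat_split: "x = of_real (qRe x) + qim x"
  by (simp add: qim_def)

lemma of_real_add_imag_sel:
  assumes "qRe v = 0"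
  shows "qRe (of_real \<alpha> + v) = \<alpha>" "qim (of_real \<alpha> + v) = v"
  using assms by (simp_all add: quat_eq_iff)

lemma imag_unit_sgn_qim: "qim x \<noteq> 0 \<Longrightarrow> sgn (qim x) \<in> imag_units"
  by (simp add: imag_units_eq norm_sgn sgn_div_norm)

lemma slice_sphere_eq: "slice_sphere x = {y. qRe y = qRe x \<and> norm (qim y) = norm (qim x)}"
proof (intro set_eqI iffI)
  fix y assume "y \<in> slice_sphere x"
  then obtain \<alpha> \<beta> I J where *: "I \<in> imag_units" "J \<in> imag_units"
    "x = of_real \<alpha> + of_real \<beta> * I" "y = of_real \<alpha> + of_real \<beta> * J"
    by (auto simp: slice_sphere_def)
  then have **: "x = of_real \<alpha> + \<beta> *\<^sub>R I" "y = of_real \<alpha> + \<beta> *\<^sub>R J" "qRe I = 0" "qRe J = 0" "norm I = 1" "norm J = 1"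
    by (auto simp: scaleR_conv_of_real imag_units_eq)
  then show "y \<in> {y. qRe y = qRe x \<and> norm (qim y) = norm (qim x)}"
    by (simp add: of_real_add_imag_sel)
next
  fix y assume "y \<in> {y. qRe y = qRe x \<and> norm (qim y) = norm (qim x)}"
  then have y: "qRe y = qRe x" "norm (qim y) = norm (qim x)" by auto
  \<comment> \<open>A real quaternion has no imaginary direction; \<open>quat_i\<close> is the
    default unit for it.\<close>
  define U where "U = (\<lambda>z. if qim z = 0 then quat_i else sgn (qim z))"
  have U: "U z \<in> imag_units" for z
    using imag_unit_sgn_qim[of z] by (auto simp: U_def imag_units_def quat_unit_products)
  have "z = of_real (qRe z) + of_real (norm (qim z)) * U z" for z
    by (auto simp: U_def sgn_div_norm scaleR_conv_of_real[symmetric] qim_def)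
  from this[of x] this[of y] y U show "y \<in> slice_sphere x"
    unfolding slice_sphere_def by (metis (mono_tags, lifting) mem_Collect_eq)
qed

text \<open>The cap is the radial image of a convex cone of imaginary quaternions.\<close>

lemma connected_slice_sphere_Int_ball:
  assumes "\<epsilon> \<le> norm (qim y)"
  shows "connected (slice_sphere x \<inter> ball y \<epsilon>)"
proof (cases "\<epsilon> > 0 \<and> qim x \<noteq> 0")
  case True
  define \<beta> where "\<beta> = norm (qim x)"
  \<comment> \<open>By the law of cosines, a point \<open>z\<close> of the sphere lies in the ball
    iff \<open>qim z \<bullet> qim y\<close> exceeds \<open>\<kappa> * \<beta>\<close>. The
    hypothesis on \<epsilon> gives \<open>\<kappa> \<ge> 0\<close>, and with this sign the triangle
    inequality makes the cone \<open>C\<close> convex.\<close>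
  define \<kappa> where "\<kappa> = ((qRe x - qRe y)\<^sup>2 + \<beta>\<^sup>2 + (norm (qim y))\<^sup>2 - \<epsilon>\<^sup>2) / (2 * \<beta>)"
  have \<beta>: "\<beta> > 0" using True by (simp add: \<beta>_def)
  have "\<epsilon>\<^sup>2 \<le> (norm (qim y))\<^sup>2" using True assms by (intro power_mono) auto
  then have \<kappa>: "\<kappa> \<ge> 0"
    unfolding \<kappa>_def using \<beta> zero_le_power2[of "qRe x - qRe y"] zero_le_power2[of \<beta>]
    by (intro divide_nonneg_pos) linarith+
  have \<kappa>\<beta>: "2 * (\<kappa> * \<beta>) = (qRe x - qRe y)\<^sup>2 + \<beta>\<^sup>2 + (norm (qim y))\<^sup>2 - \<epsilon>\<^sup>2"
    using \<beta> by (simp add: \<kappa>_def)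
  have dist: "z \<in> ball y \<epsilon> \<longleftrightarrow> \<kappa> * \<beta> < qim z \<bullet> qim y" if "z \<in> slice_sphere x" for z
  proof -
    have z: "qRe z = qRe x" "norm (qim z) = \<beta>" using that by (auto simp: slice_sphere_eq \<beta>_def)
    have "z \<in> ball y \<epsilon> \<longleftrightarrow> (norm (z - y))\<^sup>2 < \<epsilon>\<^sup>2"
      using True power_strict_mono[of "norm (z - y)" \<epsilon> 2] power2_less_imp_less[of "norm (z - y)" \<epsilon>]
      by (auto simp: dist_norm norm_minus_commute[of y z])
    also have "(norm (z - y))\<^sup>2 = (qRe x - qRe y)\<^sup>2 + (norm (qim z - qim y))\<^sup>2"
      unfolding norm_sq_qRe_qim[of "z - y"] by (simp add: z qim_simps)
    also have "(norm (qim z - qim y))\<^sup>2 = \<beta>\<^sup>2 + (norm (qim y))\<^sup>2 - 2 * (qim z \<bullet> qim y)"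
      unfolding z(2)[symmetric] power2_norm_eq_inner by (simp add: inner_simps inner_commute)
    finally show ?thesis using \<kappa>\<beta> by auto
  qed
  define C where "C = {v. qRe v = 0 \<and> \<kappa> * norm v < v \<bullet> qim y}"
  have "convex C"
  proof (rule convexI)
    fix v w :: quat and s t :: real
    assume *: "v \<in> C" "w \<in> C" "0 \<le> s" "0 \<le> t" "s + t = 1"
    have "\<kappa> * norm (s *\<^sub>R v + t *\<^sub>R w) \<le> \<kappa> * (s * norm v + t * norm w)"
      using * \<kappa> norm_triangle_ineq[of "s *\<^sub>R v" "t *\<^sub>R w"] by (intro mult_left_mono) auto
    also have "\<dots> = s * (\<kappa> * norm v) + t * (\<kappa> * norm w)" by (simp add: algebra_simps)
    also have "\<dots> < s * (v \<bullet> qim y) + t * (w \<bullet> qim y)"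
    proof (cases "s = 0")
      case False
      then show ?thesis using * by (intro add_less_le_mono mult_strict_left_mono mult_left_mono) (auto simp: C_def)
    qed (use * in \<open>auto simp: C_def\<close>)
    finally show "s *\<^sub>R v + t *\<^sub>R w \<in> C"
      using * by (simp add: C_def inner_simps)
  qed
  then have "connected C" by (rule convex_connected)
  moreover have "continuous_on C (\<lambda>v. of_real (qRe x) + \<beta> *\<^sub>R sgn v)"
    by (intro continuous_intros continuous_on_sgn) (auto simp: C_def)
  ultimately have "connected ((\<lambda>v. of_real (qRe x) + \<beta> *\<^sub>R sgn v) ` C)"
    by (rule connected_continuous_image[rotated])
  also have "(\<lambda>v. of_real (qRe x) + \<beta> *\<^sub>R sgn v) ` C = slice_sphere x \<inter> ball y \<epsilon>"
  proof (intro set_eqI iffI)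
    fix z assume "z \<in> (\<lambda>v. of_real (qRe x) + \<beta> *\<^sub>R sgn v) ` C"
    then obtain v where v: "v \<in> C" "z = of_real (qRe x) + \<beta> *\<^sub>R sgn v" by auto
    have v0: "v \<noteq> 0" "qRe v = 0" using v by (auto simp: C_def)
    have z: "qRe z = qRe x" "qim z = \<beta> *\<^sub>R sgn v"
      using v0 by (simp_all add: v(2) of_real_add_imag_sel sgn_div_norm)
    have zs: "z \<in> slice_sphere x"
      using z v0 \<beta> by (simp add: slice_sphere_eq norm_sgn \<beta>_def)
    moreover have "\<kappa> * \<beta> < qim z \<bullet> qim y"
      using v(1) v0 \<beta> by (simp add: z(2) C_def sgn_div_norm field_simps)
    ultimately show "z \<in> slice_sphere x \<inter> ball y \<epsilon>" using dist by blast
  next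
    fix z assume z: "z \<in> slice_sphere x \<inter> ball y \<epsilon>"
    then have "qim z \<in> C" using dist[of z] by (auto simp: C_def slice_sphere_eq \<beta>_def)
    moreover have "z = of_real (qRe x) + \<beta> *\<^sub>R sgn (qim z)"
      using z \<beta> by (auto simp: slice_sphere_eq sgn_div_norm \<beta>_def qim_def)
    ultimately show "z \<in> (\<lambda>v. of_real (qRe x) + \<beta> *\<^sub>R sgn v) ` C" by blast
  qed
  finally show ?thesis .
next
  case False
  \<comment> \<open>Either the ball is empty or the sphere degenerates to a real point.\<close>
  have "slice_sphere x \<inter> ball y \<epsilon> \<subseteq> {x}"
  proof
    fix z assume z: "z \<in> slice_sphere x \<inter> ball y \<epsilon>"
    have "0 \<le> dist y z" "dist y z < \<epsilon>" using z by simp_all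
    with False have "qim x = 0" by linarith
    moreover from this z have "qim z = 0" "qRe z = qRe x" by (auto simp: slice_sphere_eq)
    ultimately show "z \<in> {x}"
      using quat_split[of z] quat_split[of x] by simp
  qed
  then show ?thesis by (metis connected_empty connected_sing subset_singletonD)
qed

text \<open>Local constancy gives equal values only on connected pieces, and
  \<open>slice_sphere x \<inter> \<Omega>\<close> may be disconnected. The ball cuts a connected,
  relatively open cap out of it.\<close>

lemma locally_constant_on_slice_sphere:
  assumes loc: "locally (\<lambda>U. h constant_on U) (slice_sphere x \<inter> \<Omega>)"
    and ball: "ball y \<epsilon> \<subseteq> \<Omega>" "\<epsilon> \<le> norm (qim y)"
    and x: "x \<in> ball y \<epsilon>" "x' \<in> ball y \<epsilon>" "qRe x' = qRe x" "norm (qim x') = norm (qim x)"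
  shows "h x' = h x"
proof -
  have "slice_sphere x \<inter> ball y \<epsilon> = (slice_sphere x \<inter> \<Omega>) \<inter> ball y \<epsilon>"
    using ball by auto
  then have "openin (top_of_set (slice_sphere x \<inter> \<Omega>)) (slice_sphere x \<inter> ball y \<epsilon>)"
    by (simp add: openin_open_Int)
  then have "h constant_on (slice_sphere x \<inter> ball y \<epsilon>)"
    using locally_open_subset[OF loc] locally_constant[OF connected_slice_sphere_Int_ball[OF ball(2)]] by blast
  moreover have "x \<in> slice_sphere x \<inter> ball y \<epsilon>" "x' \<in> slice_sphere x \<inter> ball y \<epsilon>"
    using x by (auto simp: slice_sphere_eq)
  ultimately show ?thesis unfolding constant_on_def by metis
qed

text \<open>The second unit must differ from \<open>I\<close>, so that \<open>I - J\<close> is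
  invertible, yet be so near that both slices pass through one small ball. Normalizing
  \<open>I + t K\<close> for small \<open>t > 0\<close>, with \<open>K\<close> not parallel to
  \<open>I\<close>, achieves this.\<close>

lemma ex_near_imag_unit:
  assumes "I \<in> imag_units" "\<epsilon> > 0"
  obtains J where "J \<in> imag_units" "J \<noteq> I" "dist J I < \<epsilon>"
proof -
  have I: "qRe I = 0" "norm I = 1" using assms by (auto simp: imag_units_eq)
  have "quat_i \<noteq> quat_j" "quat_i \<noteq> - quat_j"
    by (auto simp: quat_eq_iff quat_i_def quat_j_def)
  then obtain K where K: "K \<in> {quat_i, quat_j}" "K \<noteq> I" "K \<noteq> - I"
    by (metis insertI1 insertI2 minus_minus)
  then have K': "qRe K = 0" "norm K = 1"
    by (auto simp: quat_i_def quat_j_def norm_quat_def)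
  have ni: "K \<noteq> c *\<^sub>R I" for c
  proof
    assume eq: "K = c *\<^sub>R I"
    then have "\<bar>c\<bar> = 1" using K' I by auto
    then have "c = 1 \<or> c = -1" by linarith
    then show False using eq K by auto
  qed
  have "((\<lambda>t. sgn (I + t *\<^sub>R K)) \<longlongrightarrow> sgn (I + 0 *\<^sub>R K)) (at_right 0)"
    using I by (intro tendsto_intros) auto
  moreover have "sgn I = I" using I by (simp add: sgn_div_norm)
  ultimately have "((\<lambda>t. sgn (I + t *\<^sub>R K)) \<longlongrightarrow> I) (at_right 0)" by simp
  from tendstoD[OF this assms(2)]
  have "eventually (\<lambda>t. dist (sgn (I + t *\<^sub>R K)) I < \<epsilon> \<and> t > 0) (at_right 0)"
    using eventually_at_right_less[of "0::real"] by eventually_elim simp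
  then obtain t where t: "dist (sgn (I + t *\<^sub>R K)) I < \<epsilon>" "t > 0"
    using eventually_happens'[OF trivial_limit_at_right_real] by blast
  have *: "I + t *\<^sub>R K \<noteq> c *\<^sub>R I" for c
  proof
    assume "I + t *\<^sub>R K = c *\<^sub>R I"
    then have "t *\<^sub>R K = (c - 1) *\<^sub>R I" by (simp add: algebra_simps)
    then have "K = ((c - 1) / t) *\<^sub>R I"
      using t(2) by (metis divideR_right divide_inverse_commute order_less_irrefl scaleR_scaleR)
    then show False using ni by blast
  qed
  have n0: "I + t *\<^sub>R K \<noteq> 0" using *[of 0] by simp
  show ?thesis
  proof (rule that)
    show "sgn (I + t *\<^sub>R K) \<in> imag_units"
      using n0 I K' by (simp add: imag_units_eq norm_sgn) (simp add: sgn_div_norm)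
    show "sgn (I + t *\<^sub>R K) \<noteq> I"
    proof
      assume "sgn (I + t *\<^sub>R K) = I"
      then have "I + t *\<^sub>R K = norm (I + t *\<^sub>R K) *\<^sub>R I"
        using n0 by (metis divideR_right norm_eq_zero sgn_div_norm)
      then show False using * by blast
    qed
  qed (rule t)
qed

section \<open>Locally slice-regular functions\<close>

lemma partial_deriv_eq:
  assumes "(f has_derivative D) (at x)"
  shows "partial_deriv e f x = D e"
proof -
  have "((\<lambda>t. x + t *\<^sub>R e) has_derivative (\<lambda>t. t *\<^sub>R e)) (at 0)"
    by (auto intro!: derivative_eq_intros)
  from has_derivative_compose[OF this, of f D] assms
  have "((\<lambda>t. f (x + t *\<^sub>R e)) has_derivative (\<lambda>t. D (t *\<^sub>R e))) (at 0)"
    by simp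
  moreover have "linear D" using assms by (rule has_derivative_linear)
  ultimately show ?thesis
    unfolding partial_deriv_def
    by (intro vector_derivative_at) (simp add: has_vector_derivative_def linear_cmul)
qed

lemma crf_op_eq:
  assumes "(f has_derivative D) (at x)"
  shows "crf_op f x = (1 / 2) *\<^sub>R (D 1 + quat_i * D quat_i + quat_j * D quat_j + quat_k * D quat_k)"
  by (simp add: crf_op_def partial_deriv_eq[OF assms])

text \<open>A slice plane has empty interior, so the derivative within it can be compared with the
  full one only along the plane. On lines in the plane both become derivatives at 0 of the same
  function of \<open>t\<close>, which are unique.\<close>

lemma slice_holomorphic_imp_derivative:
  assumes D: "(f has_derivative D) (at x)" and x: "x \<in> \<Omega>" "open \<Omega>" "x \<in> slice_plane I"
    and hol: "slice_holomorphic_on I (\<Omega> \<inter> slice_plane I) f"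
  shows "D I = I * D 1"
proof -
  let ?U = "\<Omega> \<inter> slice_plane I"
  from hol x obtain D' where D': "(f has_derivative D') (at x within ?U)"
    "\<And>v. v \<in> slice_plane I \<Longrightarrow> D' (I * v) = I * D' v"
    unfolding slice_holomorphic_on_def by blast
  have sub: "subspace (slice_plane I)"
    by (simp add: slice_plane_def)
  have DD': "D v = D' v" if v: "v \<in> slice_plane I" for v
  proof -
    let ?T = "{t. x + t *\<^sub>R v \<in> \<Omega>}"
    have "open ((\<lambda>t. x + t *\<^sub>R v) -` \<Omega>)"
      using x by (intro open_vimage continuous_intros)
    then have T: "open ?T" "0 \<in> ?T" using x by (auto simp: vimage_def)
    have g: "((\<lambda>t. x + t *\<^sub>R v) has_derivative (\<lambda>t. t *\<^sub>R v)) (at 0 within ?T)"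
      by (auto intro!: derivative_eq_intros)
    have sub': "(\<lambda>t. x + t *\<^sub>R v) ` ?T \<subseteq> ?U"
      using sub v x by (auto intro!: subspace_add subspace_scale)
    have "((\<lambda>t. f (x + t *\<^sub>R v)) has_derivative (\<lambda>t. D' (t *\<^sub>R v))) (at 0 within ?T)"
      using has_derivative_in_compose[OF g, of f D'] has_derivative_subset[OF D'(1) sub'] by simp
    then have "((\<lambda>t. f (x + t *\<^sub>R v)) has_derivative (\<lambda>t. D' (t *\<^sub>R v))) (at 0)"
      using at_within_open[OF T(2,1)] by simp
    moreover have "((\<lambda>t. f (x + t *\<^sub>R v)) has_derivative (\<lambda>t. D (t *\<^sub>R v))) (at 0)"
      using has_derivative_compose[of "\<lambda>t. x + t *\<^sub>R v" "\<lambda>t. t *\<^sub>R v" 0 UNIV f D] g D at_within_open[OF T(2,1)] by simp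
    ultimately have "(\<lambda>t. D' (t *\<^sub>R v)) = (\<lambda>t. D (t *\<^sub>R v))"
      by (rule has_derivative_unique)
    from fun_cong[OF this, of 1] show ?thesis by simp
  qed
  have "I \<in> slice_plane I" "1 \<in> slice_plane I"
    unfolding slice_plane_def by (auto intro: span_base)
  then show ?thesis
    using DD' D'(2)[of 1] by simp
qed

lemma mem_slice_plane: "of_real \<alpha> + \<beta> *\<^sub>R I \<in> slice_plane I"
  unfolding slice_plane_def of_real_def
  by (intro span_add span_scale span_base) auto

lemma bounded_linear_qcnj: "bounded_linear qcnj"
  by (auto intro!: linearI linear_linear[THEN iffD2] simp: quat_eq_iff linear_conv_bounded_linear[symmetric])

section \<open>Decomposition of a locally slice-regular function\<close>

locale sr_loc =
  fixes \<Omega> :: "quat set" and f :: "quat \<Rightarrow> quat"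
  assumes op: "open \<Omega>" and f: "f \<in> SR_loc \<Omega>"
begin

abbreviation h :: "quat \<Rightarrow> quat" where "h \<equiv> crf_op f"
abbreviation g :: "quat \<Rightarrow> quat" where "g \<equiv> crf_op (\<lambda>x. x * f x)"

definition f' :: "quat \<Rightarrow> quat \<Rightarrow>\<^sub>L quat" where
  "f' = (SOME f'. (\<forall>x\<in>\<Omega>. (f has_derivative blinfun_apply (f' x)) (at x)) \<and> continuous_on \<Omega> f')"

lemma f': "x \<in> \<Omega> \<Longrightarrow> (f has_derivative blinfun_apply (f' x)) (at x)" "continuous_on \<Omega> f'"
proof -
  have "\<exists>f' :: quat \<Rightarrow> quat \<Rightarrow>\<^sub>L quat. (\<forall>x\<in>\<Omega>. (f has_derivative blinfun_apply (f' x)) (at x)) \<and> continuous_on \<Omega> f'"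
    using f unfolding SR_loc_def C1_on_def by blast
  from someI_ex[OF this] show "x \<in> \<Omega> \<Longrightarrow> (f has_derivative blinfun_apply (f' x)) (at x)" "continuous_on \<Omega> f'"
    unfolding f'_def by blast+
qed

lemma f'_slice:
  assumes "of_real \<alpha> + \<beta> *\<^sub>R I \<in> \<Omega>" "I \<in> imag_units"
  shows "f' (of_real \<alpha> + \<beta> *\<^sub>R I) I = I * f' (of_real \<alpha> + \<beta> *\<^sub>R I) 1"
proof (rule slice_holomorphic_imp_derivative[OF f'(1)[OF assms(1)] assms(1) op mem_slice_plane])
  show "slice_holomorphic_on I (\<Omega> \<inter> slice_plane I) f"
    using f assms mem_slice_plane unfolding SR_loc_def by blast
qed

lemma continuous_on_f: "continuous_on \<Omega> f"
  using f'(1) by (auto intro!: continuous_at_imp_continuous_on has_derivative_continuous)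

lemma crf_f: "x \<in> \<Omega> \<Longrightarrow> h x = (1 / 2) *\<^sub>R (f' x 1 + quat_i * f' x quat_i + quat_j * f' x quat_j + quat_k * f' x quat_k)"
  by (rule crf_op_eq[OF f'(1)])

lemma continuous_on_h: "continuous_on \<Omega> h"
proof -
  have "continuous_on \<Omega> (\<lambda>x. (1 / 2) *\<^sub>R (f' x 1 + quat_i * f' x quat_i + quat_j * f' x quat_j + quat_k * f' x quat_k))"
    by (intro continuous_intros f'(2))
  then show ?thesis
    by (simp add: crf_f cong: continuous_on_cong)
qed

text \<open>In \<open>g\<close> the terms without derivatives add up to \<open>- f x\<close>,
  because \<open>1 + i^2 + j^2 + k^2 = -2\<close>. For the others, \<open>qcnj x * e - e * x\<close>
  is \<open>- 2 * qim x\<close> for \<open>e = 1\<close> and twice the coordinate of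
  \<open>x\<close> along \<open>e\<close> for \<open>e = i, j, k\<close>. What is left over is
  \<open>D (qim x) - qim x * D 1\<close> for the differential \<open>D\<close> at \<open>x\<close>,
  which vanishes by holomorphy on the slice, and trivially at real points.\<close>

lemma f_decomposition:
  assumes x: "x \<in> \<Omega>"
  shows "f x = qcnj x * h x - g x"
proof -
  let ?D = "f' x"
  have Dq: "?D (qim x) = qim x * ?D 1"
  proof (cases "qim x = 0")
    case False
    define I where "I = sgn (qim x)"
    have x_eq: "of_real (qRe x) + norm (qim x) *\<^sub>R I = x" "qim x = norm (qim x) *\<^sub>R I"
      using False by (simp_all add: I_def sgn_div_norm qim_def)
    have "?D I = I * ?D 1"
      using f'_slice[of "qRe x" "norm (qim x)" I] False imag_unit_sgn_qim[of x] x
      unfolding x_eq(1) by (simp add: I_def)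
    then have "norm (qim x) *\<^sub>R ?D I = (norm (qim x) *\<^sub>R I) * ?D 1" by simp
    then show ?thesis
      unfolding blinfun.scaleR_right[symmetric] x_eq(2)[symmetric] .
  qed (simp add: blinfun.zero_right)
  have "qim x = qI x *\<^sub>R quat_i + qJ x *\<^sub>R quat_j + qK x *\<^sub>R quat_k"
    by (simp add: quat_eq_iff quat_i_def quat_j_def quat_k_def)
  with Dq have rel: "qI x *\<^sub>R ?D quat_i + qJ x *\<^sub>R ?D quat_j + qK x *\<^sub>R ?D quat_k = qim x * ?D 1"
    by (metis (no_types) blinfun.add_right blinfun.scaleR_right)
  have "((\<lambda>x. x * f x) has_derivative (\<lambda>v. x * ?D v + v * f x)) (at x)"
    by (intro has_derivative_mult has_derivative_ident f'(1) x)
  note gx = crf_op_eq[OF this]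
  have aux: "F = qcnj x * ((1 / 2) *\<^sub>R (P0 + quat_i * P1 + quat_j * P2 + quat_k * P3))
      - (1 / 2) *\<^sub>R (x * P0 + 1 * F + quat_i * (x * P1 + quat_i * F) + quat_j * (x * P2 + quat_j * F) + quat_k * (x * P3 + quat_k * F))"
    if "qI x *\<^sub>R P1 + qJ x *\<^sub>R P2 + qK x *\<^sub>R P3 = qim x * P0" for F P0 P1 P2 P3 :: quat
    using that unfolding quat_eq_iff quat_i_def quat_j_def quat_k_def
    by (simp add: algebra_simps)
  show ?thesis
    unfolding crf_f[OF x] gx by (rule aux[OF rel])
qed

lemma continuous_on_g: "continuous_on \<Omega> g"
proof -
  have "continuous_on \<Omega> (\<lambda>x. qcnj x * h x - f x)"
    by (intro continuous_intros continuous_on_h continuous_on_f linear_continuous_on bounded_linear_qcnj)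
  moreover have "qcnj x * h x - f x = g x" if "x \<in> \<Omega>" for x
    using f_decomposition[OF that] by simp
  ultimately show ?thesis by (simp cong: continuous_on_cong)
qed

section \<open>Stem functions over a pair of slices\<close>

definition slice :: "quat \<Rightarrow> complex \<Rightarrow> quat" where
  "slice I z = of_real (Re z) + Im z *\<^sub>R I"

lemma has_derivative_slice: "(slice I has_derivative slice I) (at z)"
  unfolding slice_def[abs_def] of_real_def by (auto intro!: derivative_eq_intros)

lemma open_slice_vimage: "open U \<Longrightarrow> open (slice I -` U)"
  by (intro open_vimage continuous_at_imp_continuous_on ballI has_derivative_continuous[OF has_derivative_slice])

lemma has_derivative_f_slice:
  assumes "slice I z \<in> \<Omega>" "I \<in> imag_units"
  shows "((\<lambda>z. f (slice I z)) has_derivative (\<lambda>v. slice I v * f' (slice I z) 1)) (at z)"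
proof -
  have "((\<lambda>z. f (slice I z)) has_derivative (\<lambda>v. f' (slice I z) (slice I v))) (at z)"
    by (rule has_derivative_compose[OF has_derivative_slice f'(1)[OF assms(1)]])
  moreover have "f' (slice I z) I = I * f' (slice I z) 1"
    using f'_slice[of "Re z" "Im z" I] assms by (simp add: slice_def)
  ultimately show ?thesis
    by (simp add: slice_def of_real_def blinfun.add_right blinfun.scaleR_right distrib_right)
qed

text \<open>If \<open>f\<close> agrees with \<open>v + K w\<close> on the half planes of the units \<open>K = I\<close> and \<open>K = J\<close>, then
  \<open>w\<close> and \<open>v\<close> are the following two functions.\<close>

definition stem2 :: "quat \<Rightarrow> quat \<Rightarrow> complex \<Rightarrow> quat" where
  "stem2 I J z = inverse (I - J) * (f (slice I z) - f (slice J z))"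

definition stem1 :: "quat \<Rightarrow> quat \<Rightarrow> complex \<Rightarrow> quat" where
  "stem1 I J z = f (slice I z) - I * stem2 I J z"

text \<open>Holomorphy on the slice of \<open>K\<close> reads
  \<open>K * d1 1 - d2 1 = d1 \<i> + K * d2 \<i>\<close>. Subtracting the equations for
  \<open>K = I\<close> and \<open>K = J\<close> and cancelling \<open>I - J\<close> separates them
  into the Cauchy-Riemann equations for the pair \<open>d1\<close>, \<open>d2\<close>; the inner
  product with \<open>b\<close> makes them scalar.\<close>

lemma holomorphic_stem:
  assumes IJ: "I \<in> imag_units" "J \<in> imag_units" "J \<noteq> I"
    and W: "\<And>z. z \<in> W \<Longrightarrow> slice I z \<in> \<Omega> \<and> slice J z \<in> \<Omega>" "open W"
  shows "(\<lambda>z. Complex (stem1 I J z \<bullet> b) (stem2 I J z \<bullet> b)) holomorphic_on W"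
  unfolding holomorphic_on_open[OF W(2)]
proof
  fix z assume z: "z \<in> W"
  define P Q where "P = f' (slice I z) 1" and "Q = f' (slice J z) 1"
  define E where "E = inverse (I - J)"
  define d2 where "d2 = (\<lambda>v. E * (slice I v * P - slice J v * Q))"
  define d1 where "d1 = (\<lambda>v. slice I v * P - I * d2 v)"
  have fI: "((\<lambda>z. f (slice I z)) has_derivative (\<lambda>v. slice I v * P)) (at z)"
    and fJ: "((\<lambda>z. f (slice J z)) has_derivative (\<lambda>v. slice J v * Q)) (at z)"
    using has_derivative_f_slice[OF _ IJ(1)] has_derivative_f_slice[OF _ IJ(2)] W(1)[OF z]
    by (auto simp: P_def Q_def)
  have s2: "(stem2 I J has_derivative d2) (at z)"
    unfolding stem2_def[abs_def] d2_def E_def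
    by (intro has_derivative_mult_right has_derivative_diff fI fJ)
  have s1: "(stem1 I J has_derivative d1) (at z)"
    unfolding stem1_def[abs_def] d1_def
    by (intro has_derivative_diff fI has_derivative_mult_right s2)
  have ne: "I - J \<noteq> 0" using IJ(3) by simp
  have d_I: "slice I v * P = d1 v + I * d2 v" for v
    by (simp add: d1_def)
  have d_J: "slice J v * Q = d1 v + J * d2 v" for v
  proof -
    have "(I - J) * d2 v = slice I v * P - slice J v * Q"
      using ne by (simp add: d2_def E_def mult.assoc[symmetric])
    then show ?thesis by (simp add: d1_def algebra_simps)
  qed
  have II: "I * I = -1" "J * J = -1" using IJ by (auto simp: imag_units_def)
  have s_ii: "slice K 1 = 1" "slice K \<i> = K" for K
    by (simp_all add: slice_def)
  have "I * (d1 1 + I * d2 1) = d1 \<i> + I * d2 \<i>" "J * (d1 1 + J * d2 1) = d1 \<i> + J * d2 \<i>"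
    using d_I[of 1] d_I[of \<i>] d_J[of 1] d_J[of \<i>] by (simp_all add: s_ii)
  then have eqs: "I * d1 1 - d2 1 = d1 \<i> + I * d2 \<i>" "J * d1 1 - d2 1 = d1 \<i> + J * d2 \<i>"
    by (simp_all add: distrib_left mult.assoc[symmetric] II)
  then have "(I - J) * (d1 1 - d2 \<i>) = 0"
    by (simp add: algebra_simps)
  then have c1: "d2 \<i> = d1 1" using ne by simp
  then have c2: "d1 \<i> = - d2 1" using eqs(1) by simp
  have lin: "linear d1" "linear d2"
    using s1 s2 by (auto intro: has_derivative_linear)
  have split: "d v = Re v *\<^sub>R d 1 + Im v *\<^sub>R d \<i>" if "linear d" for d :: "complex \<Rightarrow> quat" and v
  proof -
    have "v = Re v *\<^sub>R 1 + Im v *\<^sub>R \<i>" by (simp add: complex_eq_iff)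
    then show ?thesis using that by (metis linear_add linear_cmul)
  qed
  have "((\<lambda>z. Complex (stem1 I J z \<bullet> b) (stem2 I J z \<bullet> b)) has_derivative (\<lambda>v. Complex (d1 v \<bullet> b) (d2 v \<bullet> b))) (at z)"
  proof -
    have "((\<lambda>z. of_real (stem1 I J z \<bullet> b) + \<i> * of_real (stem2 I J z \<bullet> b)) has_derivative
        (\<lambda>v. of_real (d1 v \<bullet> b) + \<i> * of_real (d2 v \<bullet> b))) (at z)"
      by (intro has_derivative_add has_derivative_mult_right has_derivative_of_real has_derivative_inner_left s1 s2)
    then show ?thesis by (simp add: Complex_eq)
  qed
  also have "(\<lambda>v. Complex (d1 v \<bullet> b) (d2 v \<bullet> b)) = (*) (Complex (d1 1 \<bullet> b) (d2 1 \<bullet> b))"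
  proof
    fix v
    have "d1 v = Re v *\<^sub>R d1 1 - Im v *\<^sub>R d2 1" "d2 v = Re v *\<^sub>R d2 1 + Im v *\<^sub>R d1 1"
      using split[OF lin(1), of v] split[OF lin(2), of v] by (simp_all add: c1 c2)
    then show "Complex (d1 v \<bullet> b) (d2 v \<bullet> b) = Complex (d1 1 \<bullet> b) (d2 1 \<bullet> b) * v"
      by (simp add: complex_eq_iff inner_simps mult.commute)
  qed
  finally show "\<exists>f'. ((\<lambda>z. Complex (stem1 I J z \<bullet> b) (stem2 I J z \<bullet> b)) has_field_derivative f') (at z)"
    unfolding has_field_derivative_def by blast
qed

lemma stem_eq:
  assumes IJ: "I \<in> imag_units" "J \<in> imag_units" "J \<noteq> I"
    and z: "slice I z \<in> \<Omega>" "slice J z \<in> \<Omega>"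
    and H: "h (slice I z) = H" "h (slice J z) = H" "g (slice I z) = G" "g (slice J z) = G"
  shows "stem2 I J z = - Im z *\<^sub>R H" "stem1 I J z = Re z *\<^sub>R H - G"
proof -
  have cnj: "qcnj (slice K z) = of_real (Re z) - Im z *\<^sub>R K" if "K \<in> imag_units" for K
    using that by (simp add: slice_def quat_eq_iff imag_units_eq)
  have fI: "f (slice I z) = (of_real (Re z) - Im z *\<^sub>R I) * H - G"
    and fJ: "f (slice J z) = (of_real (Re z) - Im z *\<^sub>R J) * H - G"
    using f_decomposition[OF z(1)] f_decomposition[OF z(2)] H cnj IJ by simp_all
  have "f (slice I z) - f (slice J z) = (I - J) * (- Im z *\<^sub>R H)"
    unfolding fI fJ by (simp add: algebra_simps)
  then show s2: "stem2 I J z = - Im z *\<^sub>R H"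
    using IJ(3) unfolding stem2_def by (simp only: mult.assoc[symmetric]) simp
  show "stem1 I J z = Re z *\<^sub>R H - G"
    unfolding stem1_def s2 fI by (simp add: algebra_simps scaleR_conv_of_real[symmetric])
qed

lemma has_laplacian_h_g:
  assumes y: "y \<in> \<Omega>" "qim y \<noteq> 0"
  shows "has_laplacian (\<lambda>x. h x \<bullet> b) y 0" "has_laplacian (\<lambda>x. g x \<bullet> b) y 0"
proof -
  define \<beta> where "\<beta> = norm (qim y)"
  have \<beta>: "\<beta> > 0" using y by (simp add: \<beta>_def)
  obtain \<epsilon>0 where "\<epsilon>0 > 0" "ball y \<epsilon>0 \<subseteq> \<Omega>"
    using op y open_contains_ball by blast
  \<comment> \<open>A radius of at most \<beta>, the distance from \<open>y\<close> to the real
    axis, keeps the spherical caps connected.\<close>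
  then obtain \<epsilon> where \<epsilon>: "\<epsilon> > 0" "\<epsilon> \<le> \<beta>" "ball y \<epsilon> \<subseteq> \<Omega>"
    using \<beta> by (intro that[of "min \<epsilon>0 \<beta>"]) auto
  define I where "I = sgn (qim y)"
  have I: "I \<in> imag_units" using y imag_unit_sgn_qim by (simp add: I_def)
  \<comment> \<open>The point \<open>slice J z0\<close> has distance
    \<open>\<beta> * dist J I\<close> from \<open>y\<close>, so this choice puts it into the
    ball.\<close>
  obtain J where J: "J \<in> imag_units" "J \<noteq> I" "dist J I < \<epsilon> / \<beta>"
    using ex_near_imag_unit[OF I, of "\<epsilon> / \<beta>"] \<epsilon>(1) \<beta> by auto
  define z0 where "z0 = Complex (qRe y) \<beta>"
  have yI: "slice I z0 = y"
    using y by (simp add: slice_def z0_def I_def \<beta>_def sgn_div_norm qim_def)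
  have "dist (slice J z0) y = norm (\<beta> *\<^sub>R (J - I))"
    unfolding yI[symmetric] by (simp add: slice_def z0_def dist_norm algebra_simps)
  also have "\<dots> = \<beta> * dist J I"
    using \<beta> by (simp only: norm_scaleR dist_norm abs_of_pos)
  also have "\<dots> < \<epsilon>"
    using J(3) \<beta> by (simp add: pos_less_divide_eq mult.commute)
  finally have yJ: "slice J z0 \<in> ball y \<epsilon>" by (simp add: dist_commute)
  define W where "W = slice I -` ball y \<epsilon> \<inter> slice J -` ball y \<epsilon>"
  have W: "open W" "z0 \<in> W" "\<And>z. z \<in> W \<Longrightarrow> slice I z \<in> \<Omega> \<and> slice J z \<in> \<Omega>"
    using \<epsilon> yI yJ by (auto simp: W_def open_slice_vimage)
  define F where "F = (\<lambda>z. Complex (stem1 I J z \<bullet> b) (stem2 I J z \<bullet> b))"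
  have F: "F holomorphic_on W"
    unfolding F_def by (rule holomorphic_stem[OF I J(1,2) W(3,1)])
  define \<zeta> where "\<zeta> = (\<lambda>x. Complex (qRe x) (norm (qim x)))"
  have ev: "eventually (\<lambda>x. x \<in> ball y \<epsilon> \<and> \<zeta> x \<in> W \<and> qim x \<noteq> 0) (nhds y)"
  proof -
    have "continuous_on UNIV \<zeta>"
      unfolding \<zeta>_def Complex_eq by (intro continuous_intros)
    then have "open (ball y \<epsilon> \<inter> \<zeta> -` W \<inter> {x. qim x \<noteq> 0})"
      using W(1) by (intro open_Int open_ball open_vimage open_Collect_neq continuous_intros) auto
    moreover have "y \<in> ball y \<epsilon> \<inter> \<zeta> -` W \<inter> {x. qim x \<noteq> 0}"
      using \<epsilon> W(2) y by (simp add: \<zeta>_def z0_def \<beta>_def)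
    ultimately have "eventually (\<lambda>x. x \<in> ball y \<epsilon> \<inter> \<zeta> -` W \<inter> {x. qim x \<noteq> 0}) (nhds y)"
      by (rule eventually_nhds_in_open)
    then show ?thesis by eventually_elim auto
  qed
  txt \<open>On the slices, \<open>f = (\<alpha> - \<beta> K) h - g\<close>, so the stem function of \<open>f\<close> is
    \<open>F = (\<alpha> h - g) - \<i> \<beta> h\<close>, and \<open>Im (z F) = \<alpha> Im F + \<beta> Re F\<close>.\<close>
  have stem: "h x \<bullet> b = Im (- F (\<zeta> x)) / norm (qim x) \<and> g x \<bullet> b = Im (- \<zeta> x * F (\<zeta> x)) / norm (qim x)"
    if x: "x \<in> ball y \<epsilon>" "\<zeta> x \<in> W" "qim x \<noteq> 0" for x
  proof -
    have sl: "qRe (slice K (\<zeta> x)) = qRe x" "norm (qim (slice K (\<zeta> x))) = norm (qim x)" if "K \<in> imag_units" for K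
      using that by (auto simp: slice_def \<zeta>_def imag_units_eq of_real_add_imag_sel)
    have xO: "x \<in> \<Omega>" using x \<epsilon> by auto
    then have loc: "locally (\<lambda>U. h constant_on U) (slice_sphere x \<inter> \<Omega>)" "locally (\<lambda>U. g constant_on U) (slice_sphere x \<inter> \<Omega>)"
      using f by (auto simp: SR_loc_def)
    have inb: "slice I (\<zeta> x) \<in> ball y \<epsilon>" "slice J (\<zeta> x) \<in> ball y \<epsilon>"
      using x(2) by (auto simp: W_def)
    have \<epsilon>': "\<epsilon> \<le> norm (qim y)" using \<epsilon>(2) by (simp add: \<beta>_def)
    \<comment> \<open>The point \<open>x\<close> and its two lifts lie on one sphere and in one
      ball, so \<open>stem_eq\<close> applies with the values \<open>h x\<close> and
      \<open>g x\<close>.\<close>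
    note const = locally_constant_on_slice_sphere[OF loc(1) \<epsilon>(3) \<epsilon>' x(1)]
      locally_constant_on_slice_sphere[OF loc(2) \<epsilon>(3) \<epsilon>' x(1)]
    have s: "stem2 I J (\<zeta> x) = - Im (\<zeta> x) *\<^sub>R h x" "stem1 I J (\<zeta> x) = Re (\<zeta> x) *\<^sub>R h x - g x"
      using W(3)[OF x(2)] stem_eq[OF I J(1,2) _ _ const(1)[OF inb(1) sl[OF I]] const(1)[OF inb(2) sl[OF J(1)]]
        const(2)[OF inb(1) sl[OF I]] const(2)[OF inb(2) sl[OF J(1)]]] by blast+
    have n: "norm (qim x) \<noteq> 0" using x(3) by simp
    have "Im (- F (\<zeta> x)) = norm (qim x) * (h x \<bullet> b)"
      by (simp add: F_def s) (simp add: \<zeta>_def)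
    moreover have "Im (- \<zeta> x * F (\<zeta> x)) = norm (qim x) * (g x \<bullet> b)"
      by (simp add: F_def s) (simp add: \<zeta>_def inner_simps algebra_simps)
    ultimately show ?thesis using n by (metis nonzero_mult_div_cancel_left)
  qed
  have z0: "Complex (qRe y) (norm (qim y)) \<in> W" using W(2) by (simp add: z0_def \<beta>_def)
  have "has_laplacian (\<lambda>x. Im ((\<lambda>z. - F z) (\<zeta> x)) / norm (qim x)) y 0"
    unfolding \<zeta>_def by (rule has_laplacian_axial[OF _ W(1) z0 y(2)]) (intro holomorphic_intros F)
  then show "has_laplacian (\<lambda>x. h x \<bullet> b) y 0"
    by (rule has_laplacian_cong) (use ev stem in \<open>auto elim!: eventually_mono\<close>)
  have "has_laplacian (\<lambda>x. Im ((\<lambda>z. - z * F z) (\<zeta> x)) / norm (qim x)) y 0"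
    unfolding \<zeta>_def by (rule has_laplacian_axial[OF _ W(1) z0 y(2)]) (intro holomorphic_intros F)
  then show "has_laplacian (\<lambda>x. g x \<bullet> b) y 0"
    by (rule has_laplacian_cong) (use ev stem in \<open>auto elim!: eventually_mono\<close>)
qed

end

text \<open>Rescaling to the unit ball moves the real axis to the line
  \<open>qim y = - (1 / r) *\<^sub>R qim a\<close>; this is why the exceptional line carries a
  parameter \<open>c\<close>. The scalar formula is applied to each component.\<close>

lemma poisson_representation_vector:
  fixes u :: "quat \<Rightarrow> quat"
  assumes \<Omega>: "cball a r \<subseteq> \<Omega>" "0 < r" and cont: "continuous_on \<Omega> u"
    and lap: "\<And>y b. y \<in> \<Omega> \<Longrightarrow> qim y \<noteq> 0 \<Longrightarrow> has_laplacian (\<lambda>x. u x \<bullet> b) y 0"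
    and x: "x \<in> ball 0 1"
  shows "u (a + r *\<^sub>R x) = (\<integral>\<zeta>. poisson_kernel x \<zeta> *\<^sub>R u (a + r *\<^sub>R \<zeta>) \<partial>sphere_measure)"
    and "integrable sphere_measure (\<lambda>\<zeta>. poisson_kernel x \<zeta> *\<^sub>R u (a + r *\<^sub>R \<zeta>))"
proof -
  have in\<Omega>: "a + r *\<^sub>R y \<in> \<Omega>" if "y \<in> cball 0 1" for y
    using that \<Omega> by (intro subsetD[OF \<Omega>(1)]) (auto simp: dist_norm mult_le_cancel_left1)
  have cont': "continuous_on (cball 0 1) (\<lambda>y. u (a + r *\<^sub>R y))"
    using in\<Omega> by (intro continuous_on_compose2[OF cont] continuous_intros) auto
  then have "continuous_on (sphere 0 1) (\<lambda>y. u (a + r *\<^sub>R y))"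
    by (rule continuous_on_subset) auto
  then show int: "integrable sphere_measure (\<lambda>\<zeta>. poisson_kernel x \<zeta> *\<^sub>R u (a + r *\<^sub>R \<zeta>))"
    by (intro integrable_sphere_measure continuous_on_scaleR continuous_on_poisson_kernel x)
  show "u (a + r *\<^sub>R x) = (\<integral>\<zeta>. poisson_kernel x \<zeta> *\<^sub>R u (a + r *\<^sub>R \<zeta>) \<partial>sphere_measure)"
  proof (rule euclidean_eqI)
    fix b :: quat
    have "u (a + r *\<^sub>R x) \<bullet> b = (\<integral>\<zeta>. poisson_kernel x \<zeta> * (u (a + r *\<^sub>R \<zeta>) \<bullet> b) \<partial>sphere_measure)"
    proof (rule poisson_representation[where c = "- (1 / r) *\<^sub>R qim a"])
      show "continuous_on (cball 0 1) (\<lambda>y. u (a + r *\<^sub>R y) \<bullet> b)"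
        by (intro continuous_intros cont')
      show "has_laplacian (\<lambda>y. u (a + r *\<^sub>R y) \<bullet> b) y 0"
        if "y \<in> ball 0 1" "qim y \<noteq> - (1 / r) *\<^sub>R qim a" for y
      proof -
        have "qim (a + r *\<^sub>R y) \<noteq> 0"
        proof
          assume "qim (a + r *\<^sub>R y) = 0"
          then have "qim a + r *\<^sub>R qim y = 0" by (simp add: qim_simps)
          then have "(1 / r) *\<^sub>R (qim a + r *\<^sub>R qim y) = 0" by simp
          then show False
            using that(2) \<Omega>(2) by (simp add: scaleR_add_right add_eq_0_iff)
        qed
        then show ?thesis
          using has_laplacian_scale[of "\<lambda>x. u x \<bullet> b" a r y 0] lap in\<Omega>[of y] that(1) \<Omega>(2) by simp
      qed
    qed (use x in simp_all)
    also have "\<dots> = (\<integral>\<zeta>. poisson_kernel x \<zeta> *\<^sub>R u (a + r *\<^sub>R \<zeta>) \<partial>sphere_measure) \<bullet> b"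
      using int by (subst integral_inner_left[symmetric]) auto
    finally show "u (a + r *\<^sub>R x) \<bullet> b = (\<integral>\<zeta>. poisson_kernel x \<zeta> *\<^sub>R u (a + r *\<^sub>R \<zeta>) \<partial>sphere_measure) \<bullet> b" .
  qed
qed

theorem corollary25:
  fixes \<Omega> :: "quat set" and f :: "quat \<Rightarrow> quat" and a :: quat and r :: real
  assumes "open \<Omega>"
    and "f \<in> SR_loc \<Omega>"
    and "a \<in> \<Omega>"
    and "0 < r"
    and "closure (ball a r) \<subseteq> \<Omega>"
  shows "\<forall>x\<in>ball 0 1.
    f (a + r *\<^sub>R x) =
      (\<integral>\<zeta>. poisson_kernel x \<zeta> *\<^sub>R f (a + r *\<^sub>R \<zeta>) \<partial>sphere_measure)
      - r *\<^sub>R (\<integral>\<zeta>. poisson_kernel x \<zeta> *\<^sub>R ((qcnj \<zeta> - qcnj x) * crf_op f (a + r *\<^sub>R \<zeta>)) \<partial>sphere_measure)"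
proof
  fix x :: quat assume x: "x \<in> ball 0 1"
  interpret sr_loc \<Omega> f by unfold_locales (rule assms)+
  have cb: "cball a r \<subseteq> \<Omega>" using assms by simp
  have in\<Omega>: "a + r *\<^sub>R y \<in> \<Omega>" if "y \<in> cball 0 1" for y
    using that assms(4) by (intro subsetD[OF cb]) (auto simp: dist_norm mult_le_cancel_left1)
  define hh where "hh = (\<lambda>\<zeta>. poisson_kernel x \<zeta> *\<^sub>R h (a + r *\<^sub>R \<zeta>))"
  define gg where "gg = (\<lambda>\<zeta>. poisson_kernel x \<zeta> *\<^sub>R g (a + r *\<^sub>R \<zeta>))"
  have H: "h (a + r *\<^sub>R x) = (\<integral>\<zeta>. hh \<zeta> \<partial>sphere_measure)" "integrable sphere_measure hh"
    unfolding hh_def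
    by (rule poisson_representation_vector[OF cb assms(4) continuous_on_h _ x];
        erule (1) has_laplacian_h_g)+
  have G: "g (a + r *\<^sub>R x) = (\<integral>\<zeta>. gg \<zeta> \<partial>sphere_measure)" "integrable sphere_measure gg"
    unfolding gg_def
    by (rule poisson_representation_vector[OF cb assms(4) continuous_on_g _ x];
        erule (1) has_laplacian_h_g)+
  define dd where "dd = (\<lambda>\<zeta>. poisson_kernel x \<zeta> *\<^sub>R ((qcnj \<zeta> - qcnj x) * h (a + r *\<^sub>R \<zeta>)))"
  have "continuous_on (sphere 0 1) (\<lambda>\<zeta>. h (a + r *\<^sub>R \<zeta>))"
    using in\<Omega> by (intro continuous_on_compose2[OF continuous_on_h] continuous_intros) auto
  then have "continuous_on (sphere 0 1) (\<lambda>\<zeta>. (qcnj \<zeta> - qcnj x) * h (a + r *\<^sub>R \<zeta>))"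
    by (intro continuous_on_mult continuous_on_diff continuous_on_const linear_continuous_on[OF bounded_linear_qcnj])
  then have int_dd: "integrable sphere_measure dd"
    unfolding dd_def
    by (intro integrable_sphere_measure continuous_on_scaleR continuous_on_poisson_kernel x)
  have qcnj_a: "qcnj (a + r *\<^sub>R y) = qcnj a + r *\<^sub>R qcnj y" for y
    by (simp add: quat_eq_iff)
  have "(\<integral>\<zeta>. poisson_kernel x \<zeta> *\<^sub>R f (a + r *\<^sub>R \<zeta>) \<partial>sphere_measure)
      = (\<integral>\<zeta>. qcnj (a + r *\<^sub>R x) * hh \<zeta> + r *\<^sub>R dd \<zeta> - gg \<zeta> \<partial>sphere_measure)"
  proof (rule Bochner_Integration.integral_cong)
    fix \<zeta> assume "\<zeta> \<in> space sphere_measure"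
    then have "a + r *\<^sub>R \<zeta> \<in> \<Omega>" by (intro in\<Omega>) simp
    from f_decomposition[OF this]
    \<comment> \<open>Writing \<open>qcnj (a + r \<zeta>)\<close> as its value at \<open>x\<close>
      plus a remainder isolates a coefficient independent of \<zeta>. It leaves the integral, and
      the Poisson formulas for \<open>h\<close> and \<open>g\<close> then recombine to
      \<open>f (a + r x)\<close>.\<close>
    have eq: "f (a + r *\<^sub>R \<zeta>) = qcnj (a + r *\<^sub>R x) * h (a + r *\<^sub>R \<zeta>)
        + r *\<^sub>R ((qcnj \<zeta> - qcnj x) * h (a + r *\<^sub>R \<zeta>)) - g (a + r *\<^sub>R \<zeta>)"
      by (simp add: qcnj_a algebra_simps)
    show "poisson_kernel x \<zeta> *\<^sub>R f (a + r *\<^sub>R \<zeta>) = qcnj (a + r *\<^sub>R x) * hh \<zeta> + r *\<^sub>R dd \<zeta> - gg \<zeta>"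
      by (simp add: eq hh_def gg_def dd_def scaleR_right_diff_distrib scaleR_add_right mult.commute[of r])
  qed simp
  also have "\<dots> = qcnj (a + r *\<^sub>R x) * (\<integral>\<zeta>. hh \<zeta> \<partial>sphere_measure) + r *\<^sub>R (\<integral>\<zeta>. dd \<zeta> \<partial>sphere_measure)
      - (\<integral>\<zeta>. gg \<zeta> \<partial>sphere_measure)"
    using H(2) G(2) int_dd by simp
  also have "\<dots> = f (a + r *\<^sub>R x) + r *\<^sub>R (\<integral>\<zeta>. dd \<zeta> \<partial>sphere_measure)"
    using f_decomposition[OF in\<Omega>, of x] x by (simp add: H(1) G(1))
  finally show "f (a + r *\<^sub>R x) =
      (\<integral>\<zeta>. poisson_kernel x \<zeta> *\<^sub>R f (a + r *\<^sub>R \<zeta>) \<partial>sphere_measure)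
      - r *\<^sub>R (\<integral>\<zeta>. poisson_kernel x \<zeta> *\<^sub>R ((qcnj \<zeta> - qcnj x) * crf_op f (a + r *\<^sub>R \<zeta>)) \<partial>sphere_measure)"
    by (simp add: dd_def)
qed

end
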